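(* There exists an absolute constant $C>0$ such that the following holds. Let $G$ be a DAG on $\{1,\dots,K\}$ such that for every $k$ the parent set $\mathrm{pa}(k)$ is fully connected. Let $L\ge2$, let $\mathcal{Q}$ be the set of measures $\mu\in\mathcal{P}_G$ which satisfy the TV-Lipschitz condition with constant $L$ (defined in the context), and suppose that the maximum defining $d_{\rm loc}$ is attained at some $k$ satisfying $d_k\ge2$. Then for every $n\ge 1$ $$V_{\mathcal{Q}}(n)\ge C\left(n^{-2/(2+d_{\rm loc})}+n^{-1/d_{\rm max}}\right).$$
   Context: Setting: $G$ is a directed acyclic graph with nodes $\{1,\dots,K\}$, topologically sorted (every edge $i\to j$ has $i<j$); $\mathrm{pa}(k)$ is the set of parents of $k$ and $\mathrm{pre}(k)=\{1,\dots,k-1\}\setminus\mathrm{pa}(k)$. A set $J$ of nodes is fully connected if there is an edge $k\to\ell$ for all $k,\ell\in J$ with $k<\ell$. $\mathcal{X}=[0,1]^d=\mathcal{X}_1\times\dots\times\mathcal{X}_K$ with $\mathcal{X}_k=[0,1]^{d_k}$, $\mathcal{X}_I=\prod_{i\in I}\mathcal{X}_i$, $x_I=(x_i)_{i\in I}$. $\|\cdot\|$ is the sup-norm. $\mathcal{P}_G$ is the set of Borel probability measures $\mu$ on $\mathcal{X}$ with $\mu(dx)=\prod_{k=1}^K\mu(dx_k\mid x_{\mathrm{pa}(k)})$ (regular conditional distributions; marginal if $\mathrm{pa}(k)=\emptyset$). $\mathcal{W}$ is the first-order Wasserstein distance w.r.t. $\|\cdot\|$; $\mathrm{TV}(\nu,\tilde\nu)=\sup_f(\int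 f\,d\nu-\int f\,d\tilde\nu)$ over measurable $|f|\le1/2$. TV-Lipschitz condition with constant $L$ for $\mu\in\mathcal{P}_G$: for all $2\le k\le K$, all $x_{\mathrm{pa}(k)},\tilde x_{\mathrm{pa}(k)}\in\mathcal{X}_{\mathrm{pa}(k)}$ and all $x_k,\tilde x_k\in\mathcal{X}_k$: $\mathrm{TV}(\mu(dx_k\mid x_{\mathrm{pa}(k)}),\mu(dx_k\mid\tilde x_{\mathrm{pa}(k)}))\le L\|x_{\mathrm{pa}(k)}-\tilde x_{\mathrm{pa}(k)}\|$; $\mathrm{TV}(\mu(dx_{\mathrm{pre}(k)}\mid x_{\mathrm{pa}(k)}),\mu(dx_{\mathrm{pre}(k)}\mid\tilde x_{\mathrm{pa}(k)}))\le L\|x_{\mathrm{pa}(k)}-\tilde x_{\mathrm{pa}(k)}\|$; $\mathrm{TV}(\mu(dx_{\mathrm{pa}(k)}\mid x_k),\mu(dx_{\mathrm{pa}(k)}\mid\tilde x_k))\le L\|x_k-\tilde x_k\|$. (I.e. the conditional distributions admit versions with these properties; conditions involving empty index sets are void.) $d_{\mathrm{pa}(k)}=\sum_{\ell\in\mathrm{pa}(k)}d_\ell$, $d_{\rm loc}=\max_k(\max\{2,d_k\}+d_{\mathrm{pa}(k)})$, $d_{\rm max}=\max_k\max\{2,d_k\}$. $V_{\mathcal{Q}}(n)=\inf_{E_n}\sup_{\mu\in\mathcal{Q}}\int\mathcal{W}(\mu,E_n)\,d\mu^{\otimes n}$, infimum over measurable estimators $E_n:\mathcal{X}^n\to\mathcal{P}(\mathcal{X})$.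 *)

theory Defs
  imports "HOL-Probability.Probability"
begin

subsection \<open>Graphs\<close>

text \<open>A topologically sorted DAG on the nodes \<open>{1..K}\<close>, given by its edge set; acyclicity is
  implied by \<open>i < j\<close> for every edge.\<close>

definition sorted_dag :: "nat \<Rightarrow> (nat \<times> nat) set \<Rightarrow> bool" where
  "sorted_dag K G \<longleftrightarrow> (\<forall>(i, j) \<in> G. 1 \<le> i \<and> i < j \<and> j \<le> K)"

definition pa :: "(nat \<times> nat) set \<Rightarrow> nat \<Rightarrow> nat set" where
  "pa G k = {i. (i, k) \<in> G}"

definition pre :: "(nat \<times> nat) set \<Rightarrow> nat \<Rightarrow> nat set" where
  "pre G k = {1..<k} - pa G k"

definition fully_connected :: "(nat \<times> nat) set \<Rightarrow> nat set \<Rightarrow> bool" where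
  "fully_connected G J \<longleftrightarrow> (\<forall>k\<in>J. \<forall>l\<in>J. k < l \<longrightarrow> (k, l) \<in> G)"

definition d_pa :: "(nat \<times> nat) set \<Rightarrow> (nat \<Rightarrow> nat) \<Rightarrow> nat \<Rightarrow> nat" where
  "d_pa G d k = (\<Sum>l\<in>pa G k. d l)"

definition d_loc :: "nat \<Rightarrow> (nat \<times> nat) set \<Rightarrow> (nat \<Rightarrow> nat) \<Rightarrow> nat" where
  "d_loc K G d = Max ((\<lambda>k. max 2 (d k) + d_pa G d k) ` {1..K})"

definition d_max :: "nat \<Rightarrow> (nat \<Rightarrow> nat) \<Rightarrow> nat" where
  "d_max K d = Max ((\<lambda>k. max 2 (d k)) ` {1..K})"


subsection \<open>The cubes \<open>\<X>\<^sub>I\<close>\<close>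

text \<open>A point of \<open>\<X>\<^sub>I\<close>, the product of the cubes \<open>[0,1]^(d k)\<close> over \<open>k \<in> I\<close>, is a function on
  the pairs \<open>(k, i)\<close> with \<open>k \<in> I\<close>, \<open>i < d k\<close>. Thus \<open>\<X>\<^sub>k\<close> is \<open>cube d {k}\<close>, and \<open>cube d {}\<close> is a
  one-point space, so that conditioning on an empty set of nodes gives the marginal. For finite
  \<open>I\<close> the product sigma-algebra is the Borel sigma-algebra.\<close>

definition coords :: "(nat \<Rightarrow> nat) \<Rightarrow> nat set \<Rightarrow> (nat \<times> nat) set" where
  "coords d I = (SIGMA k:I. {..<d k})"

definition cube :: "(nat \<Rightarrow> nat) \<Rightarrow> nat set \<Rightarrow> (nat \<times> nat \<Rightarrow> real) measure" where
  "cube d I = (\<Pi>\<^sub>M j\<in>coords d I. restrict_space borel {0..1})"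

definition proj :: "(nat \<Rightarrow> nat) \<Rightarrow> nat set \<Rightarrow> (nat \<times> nat \<Rightarrow> real) \<Rightarrow> nat \<times> nat \<Rightarrow> real" where
  "proj d I x = restrict x (coords d I)"

text \<open>The sup-norm distance; \<open>0\<close> is inserted only to cover the one-point space.\<close>

definition sup_dist ::
  "(nat \<Rightarrow> nat) \<Rightarrow> nat set \<Rightarrow> (nat \<times> nat \<Rightarrow> real) \<Rightarrow> (nat \<times> nat \<Rightarrow> real) \<Rightarrow> real" where
  "sup_dist d I x y = Max (insert 0 ((\<lambda>j. \<bar>x j - y j\<bar>) ` coords d I))"


subsection \<open>Distances between probability measures\<close>

definition TV :: "'a measure \<Rightarrow> 'a measure \<Rightarrow> 'a measure \<Rightarrow> real" where
  "TV M \<nu> \<nu>' = (SUP f \<in> {f \<in> borel_measurable M. \<forall>x\<in>space M. \<bar>f x\<bar> \<le> 1/2}.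
     (\<integral>x. f x \<partial>\<nu>) - (\<integral>x. f x \<partial>\<nu>'))"

definition couplings :: "'a measure \<Rightarrow> 'a measure \<Rightarrow> 'a measure \<Rightarrow> ('a \<times> 'a) measure set" where
  "couplings M \<mu> \<nu> =
     {\<pi> \<in> space (prob_algebra (M \<Otimes>\<^sub>M M)). distr \<pi> M fst = \<mu> \<and> distr \<pi> M snd = \<nu>}"

definition wasserstein ::
  "(nat \<Rightarrow> nat) \<Rightarrow> nat set \<Rightarrow> (nat \<times> nat \<Rightarrow> real) measure \<Rightarrow> (nat \<times> nat \<Rightarrow> real) measure \<Rightarrow> ennreal" where
  "wasserstein d I \<mu> \<nu> =
     (INF \<pi> \<in> couplings (cube d I) \<mu> \<nu>. \<integral>\<^sup>+ (x, y). ennreal (sup_dist d I x y) \<partial>\<pi>)"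


subsection \<open>Conditional distributions and the factorization along the graph\<close>

text \<open>\<open>\<kappa>\<close> is a (regular) version of \<open>\<mu>(dx\<^sub>B | x\<^sub>A)\<close>.\<close>

definition cond_distr ::
  "(nat \<Rightarrow> nat) \<Rightarrow> (nat \<times> nat \<Rightarrow> real) measure \<Rightarrow> nat set \<Rightarrow> nat set \<Rightarrow>
   ((nat \<times> nat \<Rightarrow> real) \<Rightarrow> (nat \<times> nat \<Rightarrow> real) measure) \<Rightarrow> bool" where
  "cond_distr d \<mu> B A \<kappa> \<longleftrightarrow>
     \<kappa> \<in> cube d A \<rightarrow>\<^sub>M prob_algebra (cube d B) \<and>
     (\<forall>S\<in>sets (cube d A). \<forall>T\<in>sets (cube d B).
        emeasure \<mu> {x \<in> space \<mu>. proj d A x \<in> S \<and> proj d B x \<in> T} =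
        (\<integral>\<^sup>+ a\<in>S. emeasure (\<kappa> a) T \<partial>distr \<mu> (cube d A) (proj d A)))"

text \<open>The product of the kernels \<open>\<kappa> i (x_pa(i), dx_i)\<close> over \<open>i = 1, \<dots>, k\<close>: given
  \<open>(x_1, \<dots>, x_k)\<close>, the next block is drawn from \<open>\<kappa> (k+1)\<close> at \<open>x_pa(k+1)\<close> and appended.\<close>

primrec kernel_prod ::
  "(nat \<times> nat) set \<Rightarrow> (nat \<Rightarrow> nat) \<Rightarrow>
   (nat \<Rightarrow> (nat \<times> nat \<Rightarrow> real) \<Rightarrow> (nat \<times> nat \<Rightarrow> real) measure) \<Rightarrow>
   nat \<Rightarrow> (nat \<times> nat \<Rightarrow> real) measure" where
  "kernel_prod G d \<kappa> 0 = return (cube d {}) (\<lambda>_. undefined)"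
| "kernel_prod G d \<kappa> (Suc k) =
     kernel_prod G d \<kappa> k \<bind> (\<lambda>x.
       distr (\<kappa> (Suc k) (proj d (pa G (Suc k)) x)) (cube d {1..Suc k})
         (\<lambda>y. merge (coords d {1..k}) (coords d {Suc k}) (x, y)))"

definition graph_measures ::
  "nat \<Rightarrow> (nat \<times> nat) set \<Rightarrow> (nat \<Rightarrow> nat) \<Rightarrow> (nat \<times> nat \<Rightarrow> real) measure set" where
  "graph_measures K G d =
     {\<mu> \<in> space (prob_algebra (cube d {1..K})).
        \<exists>\<kappa>. (\<forall>k\<in>{1..K}. cond_distr d \<mu> {k} (pa G k) (\<kappa> k)) \<and> \<mu> = kernel_prod G d \<kappa> K}"

text \<open>\<open>\<mu>(dx\<^sub>B | x\<^sub>A)\<close> has a version that is \<open>L\<close>-Lipschitz from the sup-norm to total variation;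
  void if one of the index sets is empty.\<close>

definition TV_Lipschitz_cond ::
  "(nat \<Rightarrow> nat) \<Rightarrow> real \<Rightarrow> (nat \<times> nat \<Rightarrow> real) measure \<Rightarrow> nat set \<Rightarrow> nat set \<Rightarrow> bool" where
  "TV_Lipschitz_cond d L \<mu> B A \<longleftrightarrow>
     (A \<noteq> {} \<longrightarrow> B \<noteq> {} \<longrightarrow>
       (\<exists>\<kappa>. cond_distr d \<mu> B A \<kappa> \<and>
          (\<forall>x\<in>space (cube d A). \<forall>y\<in>space (cube d A).
             TV (cube d B) (\<kappa> x) (\<kappa> y) \<le> L * sup_dist d A x y)))"

definition TV_Lipschitz ::
  "nat \<Rightarrow> (nat \<times> nat) set \<Rightarrow> (nat \<Rightarrow> nat) \<Rightarrow> real \<Rightarrow> (nat \<times> nat \<Rightarrow> real) measure \<Rightarrow> bool" where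
  "TV_Lipschitz K G d L \<mu> \<longleftrightarrow>
     (\<forall>k\<in>{2..K}. TV_Lipschitz_cond d L \<mu> {k} (pa G k) \<and>
        TV_Lipschitz_cond d L \<mu> (pre G k) (pa G k) \<and>
        TV_Lipschitz_cond d L \<mu> (pa G k) {k})"


subsection \<open>The minimax risk\<close>

text \<open>Estimators are measurable for the sigma-algebra generated by the evaluations
  \<open>\<nu> \<mapsto> \<nu>(A)\<close>, which is the Borel sigma-algebra of the weak topology.\<close>

definition minimax_risk ::
  "nat \<Rightarrow> (nat \<Rightarrow> nat) \<Rightarrow> (nat \<times> nat \<Rightarrow> real) measure set \<Rightarrow> nat \<Rightarrow> ennreal" where
  "minimax_risk K d Q n =
     (INF est \<in> (\<Pi>\<^sub>M i\<in>{..<n}. cube d {1..K}) \<rightarrow>\<^sub>M prob_algebra (cube d {1..K}).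
        SUP \<mu>\<in>Q. \<integral>\<^sup>+ x. wasserstein d {1..K} \<mu> (est x) \<partial>(\<Pi>\<^sub>M i\<in>{..<n}. \<mu>))"

end

theory Submission
  imports Defs
begin

text \<open>Both rates come from Assouad's lemma. Put the uniform law on a grid of mesh \<open>h\<close> in the
  coordinates of a set \<open>S\<close> of nodes, freeze all other nodes at \<open>0\<close>, and tilt neighbouring pairs of
  grid points by \<open>\<plusminus> \<alpha>\<close>. Two tilts that differ in one pair cannot be told apart from \<open>n\<close> observations
  as long as \<open>8 n \<alpha>\<^sup>2\<close> is at most the number of grid points, while every wrong guess costs transport
  over distance of order \<open>h\<close>, so the risk is of order \<open>h \<alpha>\<close>. For the first rate \<open>S\<close> consists of
  a node attaining \<open>d_loc\<close> and its parents, and \<open>\<alpha>\<close> is of order \<open>h\<close>: the conditional laws given two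
  grid points then differ in total variation by at most the order of their distance, and
  interpolation by tents gives Lipschitz kernels. Since \<open>S\<close> is fully connected, the law factorizes
  along the graph. For the second rate \<open>S\<close> is a single node of dimension \<open>d_max\<close>, all nodes are
  independent, and \<open>\<alpha>\<close> may be constant.\<close>

subsection \<open>Finitely supported laws\<close>

text \<open>The rates come from balancing. With D random coordinates the grid has of order h^(-D)
  points. If \<open>\<alpha>\<close> is of order h, the largest admissible n is of order h^(-(D+2)),
  and the risk h^2 is n^(-2/(D+2)). If \<open>\<alpha>\<close> is constant, h and the risk are of
  order n^(-1/D). What forbids a constant \<open>\<alpha>\<close> in the first case is the Lipschitz
  condition: neighbouring grid points at distance h may have conditional laws at total variation
  distance of order \<open>\<alpha>\<close>. The law fixes its conditional laws on the grid only,
  while the condition speaks about the whole cube; the values in between are free, and choosing them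
  well is what the tents are for. All three parts of the condition are treated at once, since on a
  product grid any two disjoint sets of nodes behave alike. The assumption d_k >= 2 makes d_loc an
  actual number of coordinates, so that D = d_loc can be reached by a grid.\<close>

definition finite_law ::
  "'b measure \<Rightarrow> 'a set \<Rightarrow> ('a \<Rightarrow> real) \<Rightarrow> ('a \<Rightarrow> 'b) \<Rightarrow> 'b measure" where
  "finite_law N Z w f = distr (point_measure Z (\<lambda>z. ennreal (w z))) N f"

lemma sets_finite_law [simp]: "sets (finite_law N Z w f) = sets N"
  and space_finite_law [simp]: "space (finite_law N Z w f) = space N"
  by (simp_all add: finite_law_def)

lemma measurable_point_measure_into:
  assumes "f ` Z \<subseteq> space N"
  shows "f \<in> point_measure Z u \<rightarrow>\<^sub>M N"
  using assms by (auto simp: measurable_def space_point_measure sets_point_measure)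

lemma nn_integral_finite_law:
  assumes "finite Z" "f ` Z \<subseteq> space N" "g \<in> borel_measurable N"
  shows "(\<integral>\<^sup>+x. g x \<partial>finite_law N Z w f) = (\<Sum>z\<in>Z. ennreal (w z) * g (f z))"
  using assms
  by (simp add: finite_law_def nn_integral_distr[OF measurable_point_measure_into]
      nn_integral_point_measure_finite)

lemma emeasure_finite_law:
  assumes "finite Z" "f ` Z \<subseteq> space N" "T \<in> sets N"
  shows "emeasure (finite_law N Z w f) T = (\<Sum>z\<in>Z. ennreal (w z) * indicator T (f z))"
  using nn_integral_finite_law[OF assms(1,2), of "indicator T" w] assms(3)
  by simp

lemma integral_finite_law:
  fixes g :: "'b \<Rightarrow> real"
  assumes "finite Z" "f ` Z \<subseteq> space N" "g \<in> borel_measurable N" "\<And>z. z \<in> Z \<Longrightarrow> 0 \<le> w z"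
  shows "(\<integral>x. g x \<partial>finite_law N Z w f) = (\<Sum>z\<in>Z. w z * g (f z))"
proof -
  have "(\<integral>x. g x \<partial>finite_law N Z w f) = (\<integral>z. g (f z) \<partial>point_measure Z (\<lambda>z. ennreal (w z)))"
    unfolding finite_law_def
    by (rule integral_distr[OF measurable_point_measure_into[OF assms(2)] assms(3)])
  also have "\<dots> = (\<Sum>z\<in>Z. w z * g (f z))"
    using assms by (subst lebesgue_integral_point_measure_finite) auto
  finally show ?thesis .
qed

lemma finite_law_prob:
  assumes "finite Z" "f ` Z \<subseteq> space N" "\<And>z. z \<in> Z \<Longrightarrow> 0 \<le> w z" "sum w Z = 1"
  shows "finite_law N Z w f \<in> space (prob_algebra N)"
proof -
  have "emeasure (finite_law N Z w f) (space N) = (\<Sum>z\<in>Z. ennreal (w z))"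
    using assms by (subst emeasure_finite_law) (auto intro!: sum.cong simp: image_subset_iff simp del: sum_mult_indicator)
  also have "\<dots> = 1" using assms by (subst sum_ennreal) auto
  finally show ?thesis
    by (auto simp: space_prob_algebra intro!: prob_spaceI)
qed

lemma finite_law_eqI:
  assumes "finite Z" "f ` Z \<subseteq> space N" "sets M = sets N"
    and "\<And>T. T \<in> sets N \<Longrightarrow> emeasure M T = (\<Sum>z\<in>Z. ennreal (w z) * indicator T (f z))"
  shows "M = finite_law N Z w f"
  by (rule measure_eqI) (use assms in \<open>simp_all add: emeasure_finite_law\<close>)

subsection \<open>Cubes and tent functions\<close>

lemma finite_coords: "finite I \<Longrightarrow> finite (coords d I)"
  by (simp add: coords_def)

lemma coords_mono: "I \<subseteq> J \<Longrightarrow> coords d I \<subseteq> coords d J"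
  by (auto simp: coords_def)

lemma coords_disjoint: "A \<inter> B = {} \<Longrightarrow> coords d A \<inter> coords d B = {}"
  by (auto simp: coords_def)

lemma space_cube: "space (cube d I) = (\<Pi>\<^sub>E j\<in>coords d I. {0..1})"
  by (simp add: cube_def space_PiM)

lemma measurable_proj:
  assumes "I \<subseteq> J" shows "proj d I \<in> cube d J \<rightarrow>\<^sub>M cube d I"
  unfolding proj_def cube_def using coords_mono[OF assms] by (intro measurable_restrict_subset)

lemma proj_in_cube:
  assumes "I \<subseteq> J" "x \<in> space (cube d J)" shows "proj d I x \<in> space (cube d I)"
  using measurable_space[OF measurable_proj[OF assms(1)] assms(2)] .

lemma proj_proj: "I \<subseteq> J \<Longrightarrow> proj d I (proj d J x) = proj d I x"
  using coords_mono[of I J d] by (auto simp: proj_def fun_eq_iff)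

lemma proj_self: "x \<in> space (cube d I) \<Longrightarrow> proj d I x = x"
  by (auto simp: proj_def space_cube)

lemma measurable_cube_component:
  assumes "j \<in> coords d I" shows "(\<lambda>x. x j) \<in> borel_measurable (cube d I)"
proof -
  have "(\<lambda>x. x j) \<in> cube d I \<rightarrow>\<^sub>M restrict_space borel {0..1::real}"
    unfolding cube_def using assms by (rule measurable_component_singleton)
  then show ?thesis by (simp add: measurable_restrict_space2_iff)
qed

lemma sup_dist_le_iff:
  assumes "finite I" "0 \<le> r"
  shows "sup_dist d I x y \<le> r \<longleftrightarrow> (\<forall>j\<in>coords d I. \<bar>x j - y j\<bar> \<le> r)"
  unfolding sup_dist_def using assms finite_coords[OF assms(1)] by (subst Max_le_iff) auto

lemma sup_dist_ge:
  assumes "finite I" "j \<in> coords d I" shows "\<bar>x j - y j\<bar> \<le> sup_dist d I x y"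
  unfolding sup_dist_def using assms finite_coords[OF assms(1)] by (intro Max_ge) auto

lemma sup_dist_nonneg: "finite I \<Longrightarrow> 0 \<le> sup_dist d I x y"
  unfolding sup_dist_def using finite_coords by (intro Max_ge) auto

lemma sup_dist_commute: "sup_dist d I x y = sup_dist d I y x"
  by (simp add: sup_dist_def abs_minus_commute)

lemma sup_dist_self: "finite I \<Longrightarrow> sup_dist d I x x = 0"
  by (intro antisym) (simp_all add: sup_dist_nonneg sup_dist_le_iff)

lemma sup_dist_triangle:
  assumes "finite I" shows "sup_dist d I x z \<le> sup_dist d I x y + sup_dist d I y z"
proof -
  have "\<bar>x j - z j\<bar> \<le> sup_dist d I x y + sup_dist d I y z" if "j \<in> coords d I" for j
    using sup_dist_ge[OF assms that, of x y] sup_dist_ge[OF assms that, of y z] by linarith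
  then show ?thesis
    using assms sup_dist_nonneg[OF assms] by (subst sup_dist_le_iff) (auto intro: add_nonneg_nonneg)
qed

lemma measurable_sup_dist:
  assumes "finite I" shows "sup_dist d I x \<in> borel_measurable (cube d I)"
proof (rule borel_measurableI_le)
  fix r :: real
  show "{y \<in> space (cube d I). sup_dist d I x y \<le> r} \<in> sets (cube d I)"
  proof (cases "0 \<le> r")
    case True
    have "{y \<in> space (cube d I). \<forall>j\<in>coords d I. \<bar>x j - y j\<bar> \<le> r} \<in> sets (cube d I)"
      using finite_coords[OF assms] measurable_cube_component
      by (intro sets.sets_Collect_finite_All) (auto intro!: borel_measurable_le)
    then show ?thesis by (simp add: sup_dist_le_iff[OF assms True])
  next
    case False
    then have "{y \<in> space (cube d I). sup_dist d I x y \<le> r} = {}"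
      using sup_dist_nonneg[OF assms, of d x] by (auto simp: not_le intro: less_le_trans)
    then show ?thesis by (simp only: sets.empty_sets)
  qed
qed

section \<open>Tent functions on separated point sets\<close>

definition separated :: "(nat \<Rightarrow> nat) \<Rightarrow> nat set \<Rightarrow> real \<Rightarrow> (nat \<times> nat \<Rightarrow> real) set \<Rightarrow> bool" where
  "separated d A h P \<longleftrightarrow> (\<forall>p\<in>P. \<forall>q\<in>P. p \<noteq> q \<longrightarrow> h \<le> sup_dist d A p q)"

definition tent :: "(nat \<Rightarrow> nat) \<Rightarrow> nat set \<Rightarrow> real \<Rightarrow> (nat \<times> nat \<Rightarrow> real) \<Rightarrow> (nat \<times> nat \<Rightarrow> real) \<Rightarrow> real"
  where "tent d A h p a = max 0 (1 - 2 * sup_dist d A p a / h)"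

text \<open>A Lipschitz partition of unity interpolating the indicators of the points of \<open>P\<close>: since
  tents around different points have disjoint supports, the missing mass is nonnegative, and it
  is given to the point \<open>p\<^sub>0\<close>.\<close>

definition bump :: "(nat \<Rightarrow> nat) \<Rightarrow> nat set \<Rightarrow> real \<Rightarrow> (nat \<times> nat \<Rightarrow> real) set \<Rightarrow> (nat \<times> nat \<Rightarrow> real) \<Rightarrow>
    (nat \<times> nat \<Rightarrow> real) \<Rightarrow> (nat \<times> nat \<Rightarrow> real) \<Rightarrow> real"
  where "bump d A h P p0 p a = tent d A h p a + (if p = p0 then 1 - (\<Sum>q\<in>P. tent d A h q a) else 0)"

lemma tent_nonneg: "0 \<le> tent d A h p a" by (simp add: tent_def)

lemma tent_le_1: "finite A \<Longrightarrow> 0 < h \<Longrightarrow> tent d A h p a \<le> 1"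
  using sup_dist_nonneg[of A d p a] by (simp add: tent_def)

text \<open>The slope \<open>2 / h\<close> makes a tent live on an open ball of radius
  \<open>h / 2\<close>, so a common point of two such balls would put their centres at distance less
  than \<open>h\<close>.\<close>

lemma tent_disjoint:
  assumes "finite A" "0 < h" "separated d A h P" "p \<in> P" "q \<in> P" "p \<noteq> q" "tent d A h p a \<noteq> 0"
  shows "tent d A h q a = 0"
proof (rule ccontr)
  assume "tent d A h q a \<noteq> 0"
  with assms have "2 * sup_dist d A p a / h < 1" "2 * sup_dist d A q a / h < 1"
    by (auto simp: tent_def max_def split: if_splits)
  then have "sup_dist d A p a + sup_dist d A a q < h"
    using \<open>0 < h\<close> by (simp add: field_simps sup_dist_commute[of d A q a])
  moreover have "h \<le> sup_dist d A p q" using assms by (auto simp: separated_def)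
  ultimately show False using sup_dist_triangle[OF assms(1), of d p q a] by linarith
qed

lemma tent_at:
  assumes "finite A" "0 < h" "separated d A h P" "p \<in> P" "q \<in> P"
  shows "tent d A h p q = (if p = q then 1 else 0)"
proof (cases "p = q")
  case False
  then have "tent d A h q q \<noteq> 0" using assms by (simp add: tent_def sup_dist_self)
  from tent_disjoint[OF assms(1-3) assms(5,4) _ this] False show ?thesis by auto
qed (use assms in \<open>simp add: tent_def sup_dist_self\<close>)

lemma tent_support:
  assumes "finite A" "0 < h" "separated d A h P"
  obtains q where "\<And>p. p \<in> P \<Longrightarrow> p \<noteq> q \<Longrightarrow> tent d A h p a = 0"
proof (cases "\<exists>q\<in>P. tent d A h q a \<noteq> 0")
  case True
  then obtain q where "q \<in> P" "tent d A h q a \<noteq> 0" by auto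
  with tent_disjoint[OF assms] that[of q] show ?thesis by metis
qed (use that in auto)

lemma sum_tent_le_1:
  assumes "finite A" "0 < h" "separated d A h P" "finite P"
  shows "(\<Sum>p\<in>P. tent d A h p a) \<le> 1"
proof -
  obtain q where q: "\<And>p. p \<in> P \<Longrightarrow> p \<noteq> q \<Longrightarrow> tent d A h p a = 0"
    using tent_support[OF assms(1-3)] by metis
  have "(\<Sum>p\<in>P. tent d A h p a) = (\<Sum>p\<in>P \<inter> {q}. tent d A h p a)"
    using q assms by (intro sum.mono_neutral_right) auto
  also have "\<dots> \<le> 1" using tent_le_1[OF assms(1,2), of d q a] by (cases "q \<in> P") auto
  finally show ?thesis .
qed

lemma tent_lipschitz:
  assumes "finite A" "0 < h"
  shows "\<bar>tent d A h p a - tent d A h p b\<bar> \<le> 2 * sup_dist d A a b / h"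
proof -
  have "\<bar>sup_dist d A p a - sup_dist d A p b\<bar> \<le> sup_dist d A a b"
    using sup_dist_triangle[OF assms(1), of d p a b] sup_dist_triangle[OF assms(1), of d p b a]
    by (auto simp: sup_dist_commute[of d A b a])
  then have "\<bar>2 * sup_dist d A p a / h - 2 * sup_dist d A p b / h\<bar> \<le> 2 * sup_dist d A a b / h"
    using assms(2) by (auto simp: diff_divide_distrib[symmetric] abs_le_iff divide_right_mono)
  then show ?thesis by (auto simp: tent_def)
qed

text \<open>Only the two points carrying the tents that are active at \<open>a\<close> and at \<open>b\<close> contribute.\<close>

lemma sum_tent_lipschitz:
  assumes "finite A" "0 < h" "separated d A h P" "finite P"
  shows "(\<Sum>p\<in>P. \<bar>tent d A h p a - tent d A h p b\<bar>) \<le> 4 * sup_dist d A a b / h"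
proof -
  obtain q q' where q: "\<And>p. p \<in> P \<Longrightarrow> p \<noteq> q \<Longrightarrow> tent d A h p a = 0"
    "\<And>p. p \<in> P \<Longrightarrow> p \<noteq> q' \<Longrightarrow> tent d A h p b = 0"
    using tent_support[OF assms(1-3)] by metis
  have "(\<Sum>p\<in>P. \<bar>tent d A h p a - tent d A h p b\<bar>) = (\<Sum>p\<in>P \<inter> {q, q'}. \<bar>tent d A h p a - tent d A h p b\<bar>)"
    using q assms by (intro sum.mono_neutral_right) auto
  also have "\<dots> \<le> of_nat (card (P \<inter> {q, q'})) * (2 * sup_dist d A a b / h)"
    by (rule sum_bounded_above) (rule tent_lipschitz[OF assms(1,2)])
  also have "\<dots> \<le> 2 * (2 * sup_dist d A a b / h)"
  proof (rule mult_right_mono)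
    have "card (P \<inter> {q, q'}) \<le> card {q, q'}" by (rule card_mono) auto
    also have "\<dots> \<le> 2" by (simp add: card_insert_if)
    finally show "real (card (P \<inter> {q, q'})) \<le> 2" by simp
  qed (use assms sup_dist_nonneg[OF assms(1)] in auto)
  finally show ?thesis by simp
qed

lemma bump_nonneg:
  assumes "finite A" "0 < h" "separated d A h P" "finite P"
  shows "0 \<le> bump d A h P p0 p a"
  using sum_tent_le_1[OF assms, of a] tent_nonneg[of d A h p a] by (simp add: bump_def)

lemma sum_bump:
  assumes "finite P" "p0 \<in> P" shows "(\<Sum>p\<in>P. bump d A h P p0 p a) = 1"
  using assms by (simp add: bump_def sum.distrib)

lemma bump_at:
  assumes "finite A" "0 < h" "separated d A h P" "finite P" "p \<in> P" "q \<in> P"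
  shows "bump d A h P p0 p q = (if p = q then 1 else 0)"
proof -
  have "(\<Sum>r\<in>P. tent d A h r q) = (\<Sum>r\<in>P. if r = q then 1 else 0)"
    using assms by (intro sum.cong) (auto simp: tent_at)
  then show ?thesis using assms by (simp add: bump_def tent_at)
qed

lemma measurable_bump:
  assumes "finite A" shows "bump d A h P p0 p \<in> borel_measurable (cube d A)"
proof -
  have "tent d A h q \<in> borel_measurable (cube d A)" for q
    using measurable_sup_dist[OF assms, of d q] unfolding tent_def by measurable
  then show ?thesis unfolding bump_def by measurable
qed

text \<open>The weights add up to 1, so the value at \<open>p0\<close> can be subtracted from
  \<open>g\<close>; this cancels the leftover mass that \<open>bump\<close> places there, and only
  tents remain. At most two tents change between \<open>a\<close> and \<open>b\<close>, each with
  slope \<open>2 / h\<close>, hence the factor 4.\<close>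

lemma bump_lipschitz:
  assumes "finite A" "0 < h" "separated d A h P" "finite P" "p0 \<in> P"
    and g: "\<And>p. p \<in> P \<Longrightarrow> \<bar>g p - g p0\<bar> \<le> e"
  shows "(\<Sum>p\<in>P. bump d A h P p0 p a * g p) - (\<Sum>p\<in>P. bump d A h P p0 p b * g p)
    \<le> 4 * e * sup_dist d A a b / h"
proof -
  have e: "0 \<le> e" using g[OF assms(5)] by simp
  have eq: "(\<Sum>p\<in>P. bump d A h P p0 p x * g p) = (\<Sum>p\<in>P. tent d A h p x * (g p - g p0)) + g p0" for x
  proof -
    have "(\<Sum>p\<in>P. bump d A h P p0 p x * g p) =
        (\<Sum>p\<in>P. tent d A h p x * g p) + (\<Sum>p\<in>P. if p = p0 then (1 - (\<Sum>q\<in>P. tent d A h q x)) * g p else 0)"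
      unfolding sum.distrib[symmetric] by (rule sum.cong) (auto simp: bump_def algebra_simps)
    also have "\<dots> = (\<Sum>p\<in>P. tent d A h p x * g p) + (1 - (\<Sum>q\<in>P. tent d A h q x)) * g p0"
      using assms(4,5) by simp
    finally show ?thesis by (simp add: algebra_simps sum_subtractf sum_distrib_left)
  qed
  have "(\<Sum>p\<in>P. bump d A h P p0 p a * g p) - (\<Sum>p\<in>P. bump d A h P p0 p b * g p) =
     (\<Sum>p\<in>P. (tent d A h p a - tent d A h p b) * (g p - g p0))"
    by (simp add: eq sum_subtractf left_diff_distrib)
  also have "\<dots> \<le> (\<Sum>p\<in>P. \<bar>tent d A h p a - tent d A h p b\<bar> * e)"
  proof (rule sum_mono)
    fix p assume "p \<in> P"
    have "(tent d A h p a - tent d A h p b) * (g p - g p0) \<le> \<bar>tent d A h p a - tent d A h p b\<bar> * \<bar>g p - g p0\<bar>"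
      by (metis abs_ge_self abs_mult)
    also have "\<dots> \<le> \<bar>tent d A h p a - tent d A h p b\<bar> * e"
      using g[OF \<open>p \<in> P\<close>] by (intro mult_left_mono) auto
    finally show "(tent d A h p a - tent d A h p b) * (g p - g p0) \<le> \<bar>tent d A h p a - tent d A h p b\<bar> * e" .
  qed
  also have "\<dots> = e * (\<Sum>p\<in>P. \<bar>tent d A h p a - tent d A h p b\<bar>)"
    by (simp add: sum_distrib_left mult.commute)
  also have "\<dots> \<le> e * (4 * sup_dist d A a b / h)"
    using e sum_tent_lipschitz[OF assms(1-4)] by (rule mult_left_mono[rotated])
  finally show ?thesis by (simp add: mult_ac)
qed

subsection \<open>Conditional distributions of a law on a grid\<close>

text \<open>Separation is demanded coordinate by coordinate, which is more than separation of
  \<open>Z\<close>, because it must survive projection to every set of nodes. Strictly positive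
  weights give every fibre of a projection positive mass.\<close>

locale grid_law =
  fixes d :: "nat \<Rightarrow> nat" and K :: nat and Z :: "(nat \<times> nat \<Rightarrow> real) set"
    and w :: "(nat \<times> nat \<Rightarrow> real) \<Rightarrow> real" and h :: real
  assumes finite_Z: "finite Z" and Z_ne: "Z \<noteq> {}" and Z_cube: "Z \<subseteq> space (cube d {1..K})"
    and w_pos: "\<And>z. z \<in> Z \<Longrightarrow> 0 < w z" and sum_w: "sum w Z = 1"
    and h_pos: "0 < h"
    and grid: "\<And>x y j. x \<in> Z \<Longrightarrow> y \<in> Z \<Longrightarrow> x j \<noteq> y j \<Longrightarrow> h \<le> \<bar>x j - y j\<bar>"
begin

definition law :: "(nat \<times> nat \<Rightarrow> real) measure" where
  "law = finite_law (cube d {1..K}) Z w (\<lambda>z. z)"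

definition mass :: "nat set \<Rightarrow> (nat \<times> nat \<Rightarrow> real) \<Rightarrow> real" where
  "mass A p = (\<Sum>z\<in>{z\<in>Z. proj d A z = p}. w z)"

definition cond_mean :: "nat set \<Rightarrow> ((nat \<times> nat \<Rightarrow> real) \<Rightarrow> real) \<Rightarrow> (nat \<times> nat \<Rightarrow> real) \<Rightarrow> real"
  where "cond_mean A g p = (\<Sum>z\<in>{z\<in>Z. proj d A z = p}. w z * g z) / mass A p"

definition interp :: "nat set \<Rightarrow> (nat \<times> nat \<Rightarrow> real) \<Rightarrow> (nat \<times> nat \<Rightarrow> real) \<Rightarrow> real" where
  "interp A = bump d A h (proj d A ` Z) (proj d A (SOME z. z \<in> Z))"

text \<open>A mixture of elementary conditional laws: the fibre over \<open>p\<close> gets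
  probability \<open>interp A p a\<close>, and inside it the points keep their conditional
  weights.\<close>

definition kernel :: "nat set \<Rightarrow> nat set \<Rightarrow> (nat \<times> nat \<Rightarrow> real) \<Rightarrow> (nat \<times> nat \<Rightarrow> real) measure" where
  "kernel B A a =
     finite_law (cube d B) Z (\<lambda>z. interp A (proj d A z) a * (w z / mass A (proj d A z))) (proj d B)"

lemma w_nonneg: "z \<in> Z \<Longrightarrow> 0 \<le> w z"
  using w_pos by (auto intro: less_imp_le)

lemma some_Z: "(SOME z. z \<in> Z) \<in> Z"
  using Z_ne by (simp add: some_in_eq)

lemma separated_proj: "finite A \<Longrightarrow> separated d A h (proj d A ` Z)"
  unfolding separated_def
proof safe
  fix x y assume A: "finite A" and xy: "x \<in> Z" "y \<in> Z" "proj d A x \<noteq> proj d A y"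
  then obtain j where j: "proj d A x j \<noteq> proj d A y j" by (meson ext)
  then have "j \<in> coords d A" "x j \<noteq> y j" by (auto simp: proj_def split: if_splits)
  with grid[OF xy(1,2)] sup_dist_ge[OF A, of j d "proj d A x" "proj d A y"]
  show "h \<le> sup_dist d A (proj d A x) (proj d A y)" by (fastforce simp: proj_def)
qed

lemma mass_pos: "z \<in> Z \<Longrightarrow> 0 < mass A (proj d A z)"
  unfolding mass_def using finite_Z w_pos by (intro sum_pos) auto

lemma interp_nonneg: "finite A \<Longrightarrow> 0 \<le> interp A p a"
  unfolding interp_def using finite_Z separated_proj h_pos by (intro bump_nonneg) auto

lemma sum_interp: "(\<Sum>p\<in>proj d A ` Z. interp A p a) = 1"
  unfolding interp_def using finite_Z some_Z by (intro sum_bump) auto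

lemma interp_at:
  assumes "finite A" "x \<in> Z" "y \<in> Z"
  shows "interp A (proj d A x) (proj d A y) = (if proj d A x = proj d A y then 1 else 0)"
  unfolding interp_def using assms finite_Z separated_proj h_pos by (intro bump_at) auto

lemma cond_mean_const:
  assumes "x \<in> Z" "\<And>z. z \<in> Z \<Longrightarrow> proj d A z = proj d A x \<Longrightarrow> g z = c"
  shows "cond_mean A g (proj d A x) = c"
proof -
  have "(\<Sum>z\<in>{z\<in>Z. proj d A z = proj d A x}. w z * g z) = mass A (proj d A x) * c"
    unfolding mass_def sum_distrib_right using assms by (intro sum.cong) auto
  then show ?thesis using mass_pos[OF assms(1), of A] by (simp add: cond_mean_def)
qed

lemma cond_mean_nonneg:
  assumes "\<And>z. z \<in> Z \<Longrightarrow> 0 \<le> g z" shows "0 \<le> cond_mean A g p"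
  unfolding cond_mean_def mass_def using assms w_pos
  by (intro divide_nonneg_nonneg sum_nonneg) (auto intro!: mult_nonneg_nonneg intro: less_imp_le)

lemma cond_mean_cong:
  assumes "\<And>z. z \<in> Z \<Longrightarrow> proj d A z = p \<Longrightarrow> g z = g' z"
  shows "cond_mean A g p = cond_mean A g' p"
  unfolding cond_mean_def using assms by (auto intro!: arg_cong2[where f="(/)"] sum.cong)

text \<open>Regrouping by fibres turns an integral against \<open>kernel\<close> into an
  \<open>interp\<close>-average of conditional means, the form that \<open>bump_lipschitz\<close>
  can handle.\<close>

lemma sum_weights:
  "(\<Sum>z\<in>Z. c (proj d A z) * (w z / mass A (proj d A z)) * g z) =
   (\<Sum>p\<in>proj d A ` Z. c p * cond_mean A g p)"
proof -
  have "(\<Sum>z\<in>Z. c (proj d A z) * (w z / mass A (proj d A z)) * g z) =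
    (\<Sum>p\<in>proj d A ` Z. \<Sum>z\<in>{z\<in>Z. proj d A z = p}. c (proj d A z) * (w z / mass A (proj d A z)) * g z)"
    by (rule sum.image_gen[OF finite_Z])
  also have "\<dots> = (\<Sum>p\<in>proj d A ` Z. c p * cond_mean A g p)"
    by (rule sum.cong[OF refl]) (auto simp: cond_mean_def sum_distrib_left sum_divide_distrib intro!: sum.cong)
  finally show ?thesis .
qed

text \<open>The tower property of conditional expectation, with a factor \<open>s\<close> that is
  known from the \<open>A\<close>-coordinates: on each fibre the mass cancels the denominator of
  \<open>cond_mean\<close>.\<close>

lemma tower: "(\<Sum>z\<in>Z. w z * (s (proj d A z) * cond_mean A g (proj d A z))) = (\<Sum>z\<in>Z. w z * (s (proj d A z) * g z))"
proof -
  have "(\<Sum>z\<in>Z. w z * (s (proj d A z) * cond_mean A g (proj d A z))) =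
    (\<Sum>p\<in>proj d A ` Z. \<Sum>z\<in>{z\<in>Z. proj d A z = p}. w z * (s (proj d A z) * cond_mean A g (proj d A z)))"
    by (rule sum.image_gen[OF finite_Z])
  also have "\<dots> = (\<Sum>p\<in>proj d A ` Z. \<Sum>z\<in>{z\<in>Z. proj d A z = p}. w z * (s (proj d A z) * g z))"
  proof (rule sum.cong[OF refl])
    fix p assume "p \<in> proj d A ` Z"
    then have m: "mass A p \<noteq> 0" using mass_pos by (metis imageE less_irrefl)
    have "(\<Sum>z\<in>{z\<in>Z. proj d A z = p}. w z * (s (proj d A z) * cond_mean A g (proj d A z))) =
      (\<Sum>z\<in>{z\<in>Z. proj d A z = p}. w z * (s p * cond_mean A g p))"
      by (rule sum.cong) auto
    also have "\<dots> = s p * (mass A p * cond_mean A g p)"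
      by (simp add: mass_def sum_distrib_left sum_distrib_right mult_ac)
    also have "mass A p * cond_mean A g p = (\<Sum>z\<in>{z\<in>Z. proj d A z = p}. w z * g z)"
      using m by (simp add: cond_mean_def)
    also have "s p * \<dots> = (\<Sum>z\<in>{z\<in>Z. proj d A z = p}. w z * (s (proj d A z) * g z))"
      unfolding sum_distrib_left by (rule sum.cong) auto
    finally show "(\<Sum>z\<in>{z\<in>Z. proj d A z = p}. w z * (s (proj d A z) * cond_mean A g (proj d A z))) =
      (\<Sum>z\<in>{z\<in>Z. proj d A z = p}. w z * (s (proj d A z) * g z))" .
  qed
  also have "\<dots> = (\<Sum>z\<in>Z. w z * (s (proj d A z) * g z))"
    by (rule sum.image_gen[OF finite_Z, symmetric])
  finally show ?thesis .
qed

lemma weight_nonneg: "finite A \<Longrightarrow> z \<in> Z \<Longrightarrow> 0 \<le> interp A (proj d A z) a * (w z / mass A (proj d A z))"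
  using interp_nonneg[of A] mass_pos[of z A] w_pos[of z] by simp

lemma sum_weight: "(\<Sum>z\<in>Z. interp A (proj d A z) a * (w z / mass A (proj d A z))) = 1"
proof -
  have "(\<Sum>z\<in>Z. interp A (proj d A z) a * (w z / mass A (proj d A z)) * 1) =
    (\<Sum>p\<in>proj d A ` Z. interp A p a * cond_mean A (\<lambda>_. 1) p)"
    by (rule sum_weights)
  also have "\<dots> = (\<Sum>p\<in>proj d A ` Z. interp A p a)"
    by (rule sum.cong) (auto simp: cond_mean_const)
  finally show ?thesis by (simp add: sum_interp)
qed

lemma proj_Z: "B \<subseteq> {1..K} \<Longrightarrow> proj d B ` Z \<subseteq> space (cube d B)"
  using Z_cube proj_in_cube by blast

lemma law_prob: "law \<in> space (prob_algebra (cube d {1..K}))"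
  unfolding law_def using finite_Z Z_cube w_pos sum_w by (intro finite_law_prob) (auto intro: less_imp_le)

lemma kernel_prob:
  assumes "finite A" "B \<subseteq> {1..K}"
  shows "kernel B A a \<in> space (prob_algebra (cube d B))"
  unfolding kernel_def using finite_Z proj_Z[OF assms(2)] weight_nonneg[OF assms(1)] sum_weight
  by (intro finite_law_prob) auto

lemma emeasure_kernel:
  assumes "finite A" "B \<subseteq> {1..K}" "T \<in> sets (cube d B)"
  shows "emeasure (kernel B A a) T =
    ennreal (\<Sum>z\<in>Z. interp A (proj d A z) a * (w z / mass A (proj d A z)) * indicator T (proj d B z))"
proof -
  have "emeasure (kernel B A a) T =
    (\<Sum>z\<in>Z. ennreal (interp A (proj d A z) a * (w z / mass A (proj d A z))) * indicator T (proj d B z))"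
    unfolding kernel_def using assms by (intro emeasure_finite_law finite_Z proj_Z)
  also have "\<dots> = (\<Sum>z\<in>Z. ennreal (interp A (proj d A z) a * (w z / mass A (proj d A z)) * indicator T (proj d B z)))"
    by (rule sum.cong) (auto simp: indicator_def)
  also have "\<dots> = ennreal (\<Sum>z\<in>Z. interp A (proj d A z) a * (w z / mass A (proj d A z)) * indicator T (proj d B z))"
    by (rule sum_ennreal) (rule mult_nonneg_nonneg[OF weight_nonneg[OF assms(1)] indicator_pos_le])
  finally show ?thesis .
qed

lemma sum_weight_at:
  assumes "finite A" "x \<in> Z"
  shows "(\<Sum>z\<in>Z. interp A (proj d A z) (proj d A x) * (w z / mass A (proj d A z)) * g z) =
    cond_mean A g (proj d A x)"
proof -
  have "(\<Sum>p\<in>proj d A ` Z. interp A p (proj d A x) * cond_mean A g p) =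
    (\<Sum>p\<in>proj d A ` Z. if p = proj d A x then cond_mean A g p else 0)"
    using assms by (intro sum.cong) (auto simp: interp_at)
  also have "\<dots> = cond_mean A g (proj d A x)" using assms finite_Z by simp
  finally show ?thesis unfolding sum_weights[where c="\<lambda>p. interp A p (proj d A x)"] .
qed

lemma emeasure_kernel_at:
  assumes "finite A" "B \<subseteq> {1..K}" "T \<in> sets (cube d B)" "x \<in> Z"
  shows "emeasure (kernel B A (proj d A x)) T =
    ennreal (cond_mean A (\<lambda>z. indicator T (proj d B z)) (proj d A x))"
  unfolding emeasure_kernel[OF assms(1-3)] sum_weight_at[OF assms(1,4)] ..

lemma kernel_measurable:
  assumes "finite A" "B \<subseteq> {1..K}"
  shows "kernel B A \<in> cube d A \<rightarrow>\<^sub>M prob_algebra (cube d B)"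
proof (rule measurable_prob_algebraI)
  show "prob_space (kernel B A a)" for a
    using kernel_prob[OF assms] by (auto simp: space_prob_algebra)
  have "interp A p \<in> borel_measurable (cube d A)" for p
    unfolding interp_def by (rule measurable_bump[OF assms(1)])
  then have "(\<lambda>a. emeasure (kernel B A a) T) \<in> borel_measurable (cube d A)" if "T \<in> sets (cube d B)" for T
    by (simp add: emeasure_kernel[OF assms that])
  then show "kernel B A \<in> cube d A \<rightarrow>\<^sub>M subprob_algebra (cube d B)"
    using kernel_prob[OF assms]
    by (intro measurable_subprob_algebra)
      (auto simp: space_prob_algebra intro: prob_space_imp_subprob_space)
qed

lemma sets_law [simp]: "sets law = sets (cube d {1..K})"
  and space_law [simp]: "space law = space (cube d {1..K})"
  by (simp_all add: law_def)

text \<open>The marginal on the \<open>A\<close>-coordinates lives on the projected grid, where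
  \<open>kernel\<close> is the elementary conditional law. Both sides thus become sums over
  \<open>Z\<close>, and these agree by \<open>tower\<close> with the indicator of \<open>S\<close>
  as the factor.\<close>

lemma cond_distr_kernel:
  assumes A: "A \<subseteq> {1..K}" and B: "B \<subseteq> {1..K}"
  shows "cond_distr d law B A (kernel B A)"
  unfolding cond_distr_def
proof (intro conjI ballI)
  have fA: "finite A" using A finite_subset by blast
  show "kernel B A \<in> cube d A \<rightarrow>\<^sub>M prob_algebra (cube d B)"
    by (rule kernel_measurable[OF fA B])
  fix S T assume S: "S \<in> sets (cube d A)" and T: "T \<in> sets (cube d B)"
  let ?E = "{x \<in> space law. proj d A x \<in> S \<and> proj d B x \<in> T}"
  have E_eq: "?E = (proj d A -` S \<inter> space (cube d {1..K})) \<inter> (proj d B -` T \<inter> space (cube d {1..K}))"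
    by auto
  have E: "?E \<in> sets (cube d {1..K})"
    unfolding E_eq
    by (rule sets.Int[OF measurable_sets[OF measurable_proj[OF A] S] measurable_sets[OF measurable_proj[OF B] T]])
  have "(\<lambda>a. emeasure (kernel B A a) T) \<in> borel_measurable (cube d A)"
    using measurable_emeasure_kernel[OF measurable_prob_algebraD[OF kernel_measurable[OF fA B]] T] .
  then have meas: "(\<lambda>a. emeasure (kernel B A a) T * indicator S a) \<in> borel_measurable (cube d A)"
    using S by measurable
  have "emeasure law ?E = (\<Sum>z\<in>Z. ennreal (w z) * indicator ?E z)"
    using emeasure_finite_law[OF finite_Z _ E, of "\<lambda>z. z" w] Z_cube by (simp add: law_def)
  also have "\<dots> = (\<Sum>z\<in>Z. ennreal (w z * (indicator S (proj d A z) * indicator T (proj d B z))))"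
    using Z_cube by (intro sum.cong) (auto simp: indicator_def)
  also have "\<dots> = ennreal (\<Sum>z\<in>Z. w z * (indicator S (proj d A z) * indicator T (proj d B z)))"
    by (rule sum_ennreal) (simp add: w_nonneg)
  also have "(\<Sum>z\<in>Z. w z * (indicator S (proj d A z) * indicator T (proj d B z))) =
     (\<Sum>z\<in>Z. w z * (indicator S (proj d A z) * cond_mean A (\<lambda>z. indicator T (proj d B z)) (proj d A z)))"
    by (rule tower[symmetric])
  also have "ennreal \<dots> =
     (\<Sum>z\<in>Z. ennreal (w z * (indicator S (proj d A z) * cond_mean A (\<lambda>z. indicator T (proj d B z)) (proj d A z))))"
    by (rule sum_ennreal[symmetric]) (simp add: w_nonneg cond_mean_nonneg)
  also have "\<dots> = (\<Sum>z\<in>Z. ennreal (w z) * (emeasure (kernel B A (proj d A z)) T * indicator S (proj d A z)))"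
    using w_pos by (intro sum.cong)
      (auto simp: emeasure_kernel_at[OF fA B T] indicator_def less_imp_le ennreal_mult cond_mean_nonneg)
  also have "\<dots> = (\<integral>\<^sup>+ x. emeasure (kernel B A (proj d A x)) T * indicator S (proj d A x) \<partial>law)"
  proof -
    have "(\<lambda>x. emeasure (kernel B A (proj d A x)) T * indicator S (proj d A x)) \<in> borel_measurable (cube d {1..K})"
      by (rule measurable_compose[OF measurable_proj[OF A] meas])
    then show ?thesis
      unfolding law_def using Z_cube by (subst nn_integral_finite_law[OF finite_Z]) auto
  qed
  also have "\<dots> = (\<integral>\<^sup>+ a\<in>S. emeasure (kernel B A a) T \<partial>distr law (cube d A) (proj d A))"
    by (rule nn_integral_distr[symmetric])
      (unfold measurable_cong_sets[OF sets_law refl] measurable_cong_sets[OF sets_distr refl],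
        rule measurable_proj[OF A], rule meas)
  finally show "emeasure law ?E = (\<integral>\<^sup>+ a\<in>S. emeasure (kernel B A a) T \<partial>distr law (cube d A) (proj d A))" .
qed

text \<open>The integral of a test function against \<open>kernel\<close> interpolates its
  conditional means at the grid points, so an oscillation \<open>e\<close> of these means becomes
  the slope \<open>4 * e / h\<close>.\<close>

lemma TV_kernel_le:
  assumes A: "A \<subseteq> {1..K}" and B: "B \<subseteq> {1..K}"
    and e: "\<And>f x y. (\<And>b. b \<in> space (cube d B) \<Longrightarrow> \<bar>f b\<bar> \<le> 1/2) \<Longrightarrow> x \<in> Z \<Longrightarrow> y \<in> Z \<Longrightarrow>
      \<bar>cond_mean A (\<lambda>z. f (proj d B z)) (proj d A x) - cond_mean A (\<lambda>z. f (proj d B z)) (proj d A y)\<bar> \<le> e"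
  shows "TV (cube d B) (kernel B A a) (kernel B A b) \<le> 4 * e / h * sup_dist d A a b"
  unfolding TV_def
proof (rule cSUP_least)
  have "(\<lambda>_. 0) \<in> {f \<in> borel_measurable (cube d B). \<forall>x\<in>space (cube d B). \<bar>f x\<bar> \<le> (1::real) / 2}"
    by auto
  then show "{f \<in> borel_measurable (cube d B). \<forall>x\<in>space (cube d B). \<bar>f x\<bar> \<le> (1::real) / 2} \<noteq> {}"
    by blast
  have fA: "finite A" using A finite_subset by blast
  fix f :: "(nat \<times> nat \<Rightarrow> real) \<Rightarrow> real"
  assume "f \<in> {f \<in> borel_measurable (cube d B). \<forall>x\<in>space (cube d B). \<bar>f x\<bar> \<le> 1 / 2}"
  then have f: "f \<in> borel_measurable (cube d B)" "\<And>x. x \<in> space (cube d B) \<Longrightarrow> \<bar>f x\<bar> \<le> 1 / 2"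
    by auto
  have int: "(\<integral>x. f x \<partial>kernel B A a) = (\<Sum>p\<in>proj d A ` Z. interp A p a * cond_mean A (\<lambda>z. f (proj d B z)) p)" for a
    unfolding kernel_def
    using sum_weights[where c="\<lambda>p. interp A p a"]
    by (subst integral_finite_law[OF finite_Z proj_Z[OF B] f(1) weight_nonneg[OF fA]]) simp_all
  have "(\<integral>x. f x \<partial>kernel B A a) - (\<integral>x. f x \<partial>kernel B A b) \<le> 4 * e * sup_dist d A a b / h"
    unfolding int unfolding interp_def
    using fA h_pos separated_proj[OF fA] finite_Z some_Z e[OF f(2)]
    by (intro bump_lipschitz) auto
  then show "(\<integral>x. f x \<partial>kernel B A a) - (\<integral>x. f x \<partial>kernel B A b) \<le> 4 * e / h * sup_dist d A a b"
    by simp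
qed

lemma TV_Lipschitz_cond_law:
  assumes A: "A \<subseteq> {1..K}" and B: "B \<subseteq> {1..K}"
    and e: "\<And>f x y. (\<And>b. b \<in> space (cube d B) \<Longrightarrow> \<bar>f b\<bar> \<le> 1/2) \<Longrightarrow> x \<in> Z \<Longrightarrow> y \<in> Z \<Longrightarrow>
      \<bar>cond_mean A (\<lambda>z. f (proj d B z)) (proj d A x) - cond_mean A (\<lambda>z. f (proj d B z)) (proj d A y)\<bar> \<le> e"
    and L: "4 * e / h \<le> L"
  shows "TV_Lipschitz_cond d L law B A"
  unfolding TV_Lipschitz_cond_def
proof (intro impI exI conjI ballI)
  show "cond_distr d law B A (kernel B A)" by (rule cond_distr_kernel[OF A B])
  fix x y
  have "0 \<le> sup_dist d A x y" using A finite_subset by (intro sup_dist_nonneg) blast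
  from mult_right_mono[OF L this] TV_kernel_le[OF A B e, of x y]
  show "TV (cube d B) (kernel B A x) (kernel B A y) \<le> L * sup_dist d A x y" by (rule order_trans[rotated])
qed

subsection \<open>Factorization along the graph\<close>

lemma merge_proj:
  "merge (coords d {1..k}) (coords d {Suc k}) (proj d {1..k} z, proj d {Suc k} z) = proj d {1..Suc k} z"
  by (auto simp: merge_def proj_def coords_def fun_eq_iff)

text \<open>The next block must be conditionally independent of the past given its parents. The
  hypothesis \<open>dep\<close> secures this in a degenerate way: on \<open>Z\<close> the parents
  determine the new block, or they determine the whole past.\<close>

lemma kernel_prod_law:
  assumes G: "\<And>k. k \<in> {1..K} \<Longrightarrow> pa G k \<subseteq> {1..<k}"
    and dep: "\<And>k. Suc k \<le> K \<Longrightarrow>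
      (\<forall>x\<in>Z. \<forall>y\<in>Z. proj d (pa G (Suc k)) x = proj d (pa G (Suc k)) y \<longrightarrow> proj d {Suc k} x = proj d {Suc k} y) \<or>
      (\<forall>x\<in>Z. \<forall>y\<in>Z. proj d (pa G (Suc k)) x = proj d (pa G (Suc k)) y \<longrightarrow> proj d {1..k} x = proj d {1..k} y)"
    and "k \<le> K"
  shows "kernel_prod G d (\<lambda>k. kernel {k} (pa G k)) k = finite_law (cube d {1..k}) Z w (proj d {1..k})"
  using \<open>k \<le> K\<close>
proof (induction k)
  case 0
  \<comment> \<open>The only point of the empty product is undefined everywhere, so all of
    \<open>Z\<close> projects to the point at which \<open>kernel_prod\<close> starts.\<close>
  have "coords d {} = {}" by (simp add: coords_def)
  then have "(\<lambda>_. undefined) \<in> space (cube d {})" "\<And>z. proj d {} z = (\<lambda>_. undefined)"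
    by (auto simp: space_cube proj_def)
  moreover have "(\<Sum>z\<in>Z. ennreal (w z)) = 1"
    using sum_w w_pos by (subst sum_ennreal) (auto intro: less_imp_le)
  ultimately show ?case
    using finite_Z by (intro finite_law_eqI) (auto simp: sum_distrib_right[symmetric])
next
  case (Suc k)
  let ?A = "pa G (Suc k)" and ?B = "{Suc k}"
  let ?m = "\<lambda>x y. merge (coords d {1..k}) (coords d ?B) (x, y)"
  let ?N = "\<lambda>x. distr (kernel ?B ?A (proj d ?A x)) (cube d {1..Suc k}) (\<lambda>y. ?m x y)"
  have A: "?A \<subseteq> {1..k}" "finite ?A"
    using G[of "Suc k"] Suc.prems finite_subset[of ?A "{1..<Suc k}"] by (auto simp: less_Suc_eq_le)
  have B: "?B \<subseteq> {1..K}" using Suc.prems by auto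
  have un: "coords d {1..k} \<union> coords d ?B = coords d {1..Suc k}"
    by (auto simp: coords_def)
  have m: "merge (coords d {1..k}) (coords d ?B) \<in> cube d {1..k} \<Otimes>\<^sub>M cube d ?B \<rightarrow>\<^sub>M cube d {1..Suc k}"
    using measurable_merge[of "coords d {1..k}" "coords d ?B" "\<lambda>_. restrict_space borel {0..1::real}"]
    unfolding cube_def un .
  have ker: "(\<lambda>x. kernel ?B ?A (proj d ?A x)) \<in> cube d {1..k} \<rightarrow>\<^sub>M prob_algebra (cube d ?B)"
    by (rule measurable_compose[OF measurable_proj[OF A(1)] kernel_measurable[OF A(2) B]])
  have N: "?N \<in> cube d {1..k} \<rightarrow>\<^sub>M subprob_algebra (cube d {1..Suc k})"
    by (rule measurable_distr2[OF _ measurable_prob_algebraD[OF ker]]) (use m in simp)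
  let ?P = "finite_law (cube d {1..k}) Z w (proj d {1..k})"
  have N': "?N \<in> ?P \<rightarrow>\<^sub>M subprob_algebra (cube d {1..Suc k})"
    unfolding measurable_cong_sets[OF sets_finite_law refl] by (rule N)
  have ksub: "{1..k} \<subseteq> {1..K}" "{1..Suc k} \<subseteq> {1..K}" using Suc.prems by auto
  have ne: "space ?P \<noteq> {}" using proj_Z[OF ksub(1)] Z_ne by auto
  have "kernel_prod G d (\<lambda>k. kernel {k} (pa G k)) (Suc k) = ?P \<bind> ?N"
    using Suc by simp
  also have "\<dots> = finite_law (cube d {1..Suc k}) Z w (proj d {1..Suc k})"
  proof (rule finite_law_eqI[OF finite_Z proj_Z[OF ksub(2)]])
    show "sets (?P \<bind> ?N) = sets (cube d {1..Suc k})"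
      by (rule sets_bind) (use ne in auto)
    fix T assume T: "T \<in> sets (cube d {1..Suc k})"
    \<comment> \<open>The past of \<open>z\<close> is glued to the new block of a second point
      \<open>z'\<close> of the same fibre. By \<open>dep\<close>, taking one point for both makes no
      difference on average.\<close>
    let ?g = "\<lambda>z z'. indicator T (?m (proj d {1..k} z) (proj d ?B z')) :: real"
    have "emeasure (?P \<bind> ?N) T = (\<integral>\<^sup>+x. emeasure (?N x) T \<partial>?P)"
      by (rule emeasure_bind[OF ne N' T])
    also have "\<dots> = (\<Sum>z\<in>Z. ennreal (w z) * emeasure (?N (proj d {1..k} z)) T)"
      using N T by (intro nn_integral_finite_law finite_Z proj_Z ksub measurable_emeasure_kernel)
    also have "\<dots> = (\<Sum>z\<in>Z. ennreal (w z * cond_mean ?A (?g z) (proj d ?A z)))"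
    proof (rule sum.cong[OF refl])
      fix z assume z: "z \<in> Z"
      let ?x = "proj d {1..k} z"
      have x: "?x \<in> space (cube d {1..k})" using proj_Z[OF ksub(1)] z by auto
      have mx: "?m ?x \<in> cube d ?B \<rightarrow>\<^sub>M cube d {1..Suc k}"
        using measurable_compose[OF measurable_Pair1'[OF x] m] .
      have sk: "sets (kernel ?B ?A a) = sets (cube d ?B)" for a
        by (simp add: kernel_def)
      have sp: "space (kernel ?B ?A a) = space (cube d ?B)" for a
        by (simp add: kernel_def)
      have "emeasure (?N ?x) T = emeasure (kernel ?B ?A (proj d ?A z)) (?m ?x -` T \<inter> space (cube d ?B))"
        unfolding proj_proj[OF A(1)]
        using mx T by (subst emeasure_distr) (simp_all only: sp measurable_cong_sets[OF sk refl])
      also have "\<dots> = ennreal (cond_mean ?A (\<lambda>z'. indicator (?m ?x -` T \<inter> space (cube d ?B)) (proj d ?B z')) (proj d ?A z))"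
        using measurable_sets[OF mx T] by (intro emeasure_kernel_at A B z) auto
      also have "cond_mean ?A (\<lambda>z'. indicator (?m ?x -` T \<inter> space (cube d ?B)) (proj d ?B z')) (proj d ?A z)
        = cond_mean ?A (?g z) (proj d ?A z)"
        using proj_Z[OF B] by (intro cond_mean_cong) (auto simp: indicator_def)
      finally show "ennreal (w z) * emeasure (?N ?x) T = ennreal (w z * cond_mean ?A (?g z) (proj d ?A z))"
        using w_pos[OF z] by (simp add: ennreal_mult cond_mean_nonneg)
    qed
    also have "\<dots> = ennreal (\<Sum>z\<in>Z. w z * cond_mean ?A (?g z) (proj d ?A z))"
      by (rule sum_ennreal) (simp add: w_nonneg cond_mean_nonneg)
    also have "(\<Sum>z\<in>Z. w z * cond_mean ?A (?g z) (proj d ?A z)) = (\<Sum>z\<in>Z. w z * indicator T (proj d {1..Suc k} z))"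
      using dep[OF Suc.prems]
    proof
      assume *: "\<forall>x\<in>Z. \<forall>y\<in>Z. proj d ?A x = proj d ?A y \<longrightarrow> proj d ?B x = proj d ?B y"
      have "cond_mean ?A (?g z) (proj d ?A z) = indicator T (proj d {1..Suc k} z)" if "z \<in> Z" for z
      proof (rule cond_mean_const[OF that])
        fix y assume "y \<in> Z" "proj d ?A y = proj d ?A z"
        with * that have "proj d ?B y = proj d ?B z" by blast
        then show "?g z y = indicator T (proj d {1..Suc k} z)" by (simp only: merge_proj)
      qed
      then show ?thesis by (intro sum.cong) auto
    next
      assume *: "\<forall>x\<in>Z. \<forall>y\<in>Z. proj d ?A x = proj d ?A y \<longrightarrow> proj d {1..k} x = proj d {1..k} y"
      \<comment> \<open>The factor 1 is written out to match \<open>tower\<close> with a constant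
        \<open>s\<close>.\<close>
      have "cond_mean ?A (?g z) (proj d ?A z) =
          1 * cond_mean ?A (\<lambda>y. indicator T (proj d {1..Suc k} y)) (proj d ?A z)" if "z \<in> Z" for z
        unfolding mult_1
      proof (rule cond_mean_cong)
        fix y assume "y \<in> Z" "proj d ?A y = proj d ?A z"
        with * that have "proj d {1..k} y = proj d {1..k} z" by blast
        then have "?g z y = ?g y y" by simp
        then show "?g z y = indicator T (proj d {1..Suc k} y)" by (simp only: merge_proj)
      qed
      then have "(\<Sum>z\<in>Z. w z * cond_mean ?A (?g z) (proj d ?A z)) =
        (\<Sum>z\<in>Z. w z * (1 * cond_mean ?A (\<lambda>y. indicator T (proj d {1..Suc k} y)) (proj d ?A z)))"
        by (intro sum.cong) auto
      also have "\<dots> = (\<Sum>z\<in>Z. w z * (1 * indicator T (proj d {1..Suc k} z)))"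
        by (rule tower[where s="\<lambda>_. 1"])
      finally show ?thesis by simp
    qed
    also have "ennreal \<dots> = (\<Sum>z\<in>Z. ennreal (w z * indicator T (proj d {1..Suc k} z)))"
      by (rule sum_ennreal[symmetric]) (simp add: w_nonneg)
    also have "\<dots> = (\<Sum>z\<in>Z. ennreal (w z) * indicator T (proj d {1..Suc k} z))"
      by (rule sum.cong) (auto simp: indicator_def)
    finally show "emeasure (?P \<bind> ?N) T = (\<Sum>z\<in>Z. ennreal (w z) * indicator T (proj d {1..Suc k} z))" .
  qed
  finally show ?case .
qed

lemma law_graph_measure:
  assumes G: "\<And>k. k \<in> {1..K} \<Longrightarrow> pa G k \<subseteq> {1..<k}"
    and dep: "\<And>k. Suc k \<le> K \<Longrightarrow>
      (\<forall>x\<in>Z. \<forall>y\<in>Z. proj d (pa G (Suc k)) x = proj d (pa G (Suc k)) y \<longrightarrow> proj d {Suc k} x = proj d {Suc k} y) \<or>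
      (\<forall>x\<in>Z. \<forall>y\<in>Z. proj d (pa G (Suc k)) x = proj d (pa G (Suc k)) y \<longrightarrow> proj d {1..k} x = proj d {1..k} y)"
  shows "law \<in> graph_measures K G d"
proof -
  have "law = finite_law (cube d {1..K}) Z w (proj d {1..K})"
    unfolding law_def
    by (rule finite_law_eqI[OF finite_Z proj_Z[OF order_refl]])
      (use Z_cube in \<open>auto simp: emeasure_finite_law finite_Z proj_self subset_iff simp del: sum_mult_indicator intro!: sum.cong\<close>)
  also have "\<dots> = kernel_prod G d (\<lambda>k. kernel {k} (pa G k)) K"
    by (rule kernel_prod_law[OF G dep order_refl, symmetric])
  finally have "law = kernel_prod G d (\<lambda>k. kernel {k} (pa G k)) K" .
  moreover have "cond_distr d law {k} (pa G k) (kernel {k} (pa G k))" if "k \<in> {1..K}" for k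
    by (rule cond_distr_kernel[OF order_trans[OF G[OF that]]]) (use that in auto)
  ultimately show ?thesis
    unfolding graph_measures_def mem_Collect_eq
    by (intro conjI law_prob exI[of _ "\<lambda>k. kernel {k} (pa G k)"] ballI)
qed

end

subsection \<open>A lower bound for the Wasserstein risk\<close>

text \<open>The balls are open, so that those of radius \<open>h / 2\<close> around distinct grid
  points are disjoint. An arbitrary estimate enters the argument only through its masses on these
  balls.\<close>

definition near :: "(nat \<Rightarrow> nat) \<Rightarrow> nat set \<Rightarrow> real \<Rightarrow> (nat \<times> nat \<Rightarrow> real) \<Rightarrow> (nat \<times> nat \<Rightarrow> real) set" where
  "near d I r z = {y \<in> space (cube d I). sup_dist d I z y < r}"

lemma sets_near: "finite I \<Longrightarrow> near d I r z \<in> sets (cube d I)"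
  unfolding near_def using measurable_sup_dist by (intro borel_measurable_less) auto

lemma sup_dist_eq_0:
  assumes "finite I" "x \<in> space (cube d I)" "y \<in> space (cube d I)" "sup_dist d I x y \<le> 0"
  shows "x = y"
proof (rule PiE_ext)
  show "x \<in> (\<Pi>\<^sub>E j\<in>coords d I. {0..1})" "y \<in> (\<Pi>\<^sub>E j\<in>coords d I. {0..1})"
    using assms by (auto simp: space_cube)
  show "x j = y j" if "j \<in> coords d I" for j
    using sup_dist_ge[OF assms(1) that, of x y] assms(4) by auto
qed

lemma sets_cube_singleton:
  assumes "finite I" "x \<in> space (cube d I)" shows "{x} \<in> sets (cube d I)"
proof -
  have "{x} = {y \<in> space (cube d I). sup_dist d I x y \<le> 0}"
    using assms sup_dist_eq_0[OF assms] by (auto simp: sup_dist_self)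
  also have "\<dots> \<in> sets (cube d I)"
    using measurable_sup_dist[OF assms(1)] by (intro borel_measurable_le) auto
  finally show ?thesis .
qed

context grid_law
begin

lemma emeasure_law_singleton: "z \<in> Z \<Longrightarrow> emeasure law {z} = ennreal (w z)"
proof -
  assume z: "z \<in> Z"
  have "emeasure law {z} = (\<Sum>y\<in>Z. ennreal (w y) * indicator {z} y)"
    unfolding law_def using Z_cube z
    by (intro emeasure_finite_law[where f="\<lambda>z. z"] finite_Z sets_cube_singleton) auto
  also have "\<dots> = (\<Sum>y\<in>Z. if y = z then ennreal (w z) else 0)"
    by (rule sum.cong) auto
  finally show ?thesis using z finite_Z by simp
qed

lemma sets_Z: "S \<subseteq> Z \<Longrightarrow> S \<in> sets (cube d {1..K})"
proof -
  assume S: "S \<subseteq> Z"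
  then have "(\<Union>x\<in>S. {x}) \<in> sets (cube d {1..K})"
    using finite_Z finite_subset Z_cube by (intro sets.finite_UN sets_cube_singleton) auto
  then show ?thesis by simp
qed

lemma emeasure_law_outside: "emeasure law (space (cube d {1..K}) - Z) = 0"
proof -
  have "emeasure law (space (cube d {1..K}) - Z) =
      (\<Sum>z\<in>Z. ennreal (w z) * indicator (space (cube d {1..K}) - Z) z)"
    unfolding law_def using Z_cube
    by (intro emeasure_finite_law[where f="\<lambda>z. z"] finite_Z sets.Diff sets.top sets_Z order_refl)
      simp
  also have "\<dots> = 0" by (rule sum.neutral) auto
  finally show ?thesis .
qed

lemma sup_dist_Z: "x \<in> Z \<Longrightarrow> y \<in> Z \<Longrightarrow> x \<noteq> y \<Longrightarrow> h \<le> sup_dist d {1..K} x y"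
proof -
  assume xy: "x \<in> Z" "y \<in> Z" "x \<noteq> y"
  then have p: "proj d {1..K} x = x" "proj d {1..K} y = y" using Z_cube by (auto intro!: proj_self)
  show ?thesis
    using separated_proj[of "{1..K}", unfolded separated_def, rule_format, of "proj d {1..K} x" "proj d {1..K} y"] xy
    unfolding p by (metis finite_atLeastAtMost imageI p)
qed

text \<open>If a coupling pairs \<open>z\<close> with a point far from \<open>z\<close>, or a point near \<open>z\<close> with another grid
  point, then it moves that mass by at least \<open>h/2\<close>.\<close>

lemma wasserstein_ge:
  assumes nu: "\<nu> \<in> space (prob_algebra (cube d {1..K}))"
  shows "ennreal (h / 4 * (\<Sum>z\<in>Z. \<bar>w z - measure \<nu> (near d {1..K} (h/2) z)\<bar>)) \<le> wasserstein d {1..K} law \<nu>"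
  unfolding wasserstein_def
proof (rule INF_greatest)
  let ?M = "cube d {1..K}" and ?D = "near d {1..K} (h/2)" and ?c = "sup_dist d {1..K}"
  fix \<pi> assume "\<pi> \<in> couplings ?M law \<nu>"
  then have pi: "prob_space \<pi>" "sets \<pi> = sets (?M \<Otimes>\<^sub>M ?M)" and d1: "distr \<pi> ?M fst = law"
    and d2: "distr \<pi> ?M snd = \<nu>"
    by (auto simp: couplings_def space_prob_algebra)
  interpret P: prob_space \<pi> by (rule pi(1))
  have sp: "space \<pi> = space ?M \<times> space ?M"
    using sets_eq_imp_space_eq[OF pi(2)] by (simp add: space_pair_measure)
  \<comment> \<open>\<open>E1 z\<close> collects the mass that leaves \<open>z\<close> for a far
    place, \<open>E2 z\<close> the mass that arrives near \<open>z\<close> from another grid point.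
    Taking the sources of \<open>E2 z\<close> from \<open>Z\<close> makes the separation of the grid
    available.\<close>
  define E1 where "E1 z = {z} \<times> (space ?M - ?D z)" for z
  define E2 where "E2 z = (Z - {z}) \<times> ?D z" for z
  have meas: "?D z \<in> sets ?M" for z by (rule sets_near) simp
  have pair: "S \<times> T \<in> sets \<pi>" if "S \<in> sets ?M" "T \<in> sets ?M" for S T
    using that unfolding pi(2) by (rule pair_measureI)
  have E1: "E1 z \<in> sets \<pi>" and E2: "E2 z \<in> sets \<pi>" if "z \<in> Z" for z
    unfolding E1_def E2_def using that meas sets_Z by (auto intro!: pair)
  have m1: "measure \<pi> (S \<times> space ?M) = measure law S" if "S \<in> sets ?M" for S
  proof -
    have "fst -` S \<inter> space \<pi> = S \<times> space ?M"
      using sets.sets_into_space[OF that] by (auto simp: sp)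
    moreover have "fst \<in> \<pi> \<rightarrow>\<^sub>M ?M"
      unfolding measurable_cong_sets[OF pi(2) refl] by (rule measurable_fst)
    ultimately show ?thesis using that unfolding d1[symmetric] by (simp add: measure_distr)
  qed
  have m2: "measure \<pi> (space ?M \<times> S) = measure \<nu> S" if "S \<in> sets ?M" for S
  proof -
    have "snd -` S \<inter> space \<pi> = space ?M \<times> S"
      using sets.sets_into_space[OF that] by (auto simp: sp)
    moreover have "snd \<in> \<pi> \<rightarrow>\<^sub>M ?M"
      unfolding measurable_cong_sets[OF pi(2) refl] by (rule measurable_snd)
    ultimately show ?thesis using that unfolding d2[symmetric] by (simp add: measure_distr)
  qed
  have dev: "\<bar>w z - measure \<nu> (?D z)\<bar> \<le> measure \<pi> (E1 z) + measure \<pi> (E2 z)" if z: "z \<in> Z" for z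
  proof -
    have Dsub: "?D z \<subseteq> space ?M" by (auto simp: near_def)
    have sz: "{z} \<in> sets ?M" using sets_Z[of "{z}"] z by auto
    have wz: "measure \<pi> ({z} \<times> space ?M) = w z"
      using m1[OF sz] emeasure_law_singleton[OF z] w_nonneg[OF z] by (simp add: measure_def)
    have s0: "space ?M - Z \<in> sets ?M" using sets_Z[of Z] by auto
    \<comment> \<open>The sources outside \<open>Z\<close>, which \<open>E2\<close> leaves out,
      carry no mass.\<close>
    have out: "measure \<pi> ((space ?M - Z) \<times> space ?M) = 0"
      using m1[OF s0] emeasure_law_outside by (simp add: measure_def)
    have "measure \<pi> ({z} \<times> space ?M) \<le> measure \<pi> (E1 z \<union> space ?M \<times> ?D z)"
      using E1[OF z] meas Z_cube z by (intro P.finite_measure_mono sets.Un pair) (auto simp: E1_def)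
    also have "\<dots> \<le> measure \<pi> (E1 z) + measure \<pi> (space ?M \<times> ?D z)"
      using E1[OF z] meas by (intro measure_Un_le pair) auto
    finally have 1: "w z \<le> measure \<pi> (E1 z) + measure \<nu> (?D z)" unfolding wz m2[OF meas] .
    have "measure \<pi> (space ?M \<times> ?D z) \<le> measure \<pi> ((E2 z \<union> {z} \<times> space ?M) \<union> (space ?M - Z) \<times> space ?M)"
      using E2[OF z] meas s0 sz Dsub by (intro P.finite_measure_mono sets.Un pair) (auto simp: E2_def)
    also have "\<dots> \<le> measure \<pi> (E2 z \<union> {z} \<times> space ?M) + measure \<pi> ((space ?M - Z) \<times> space ?M)"
      using E2[OF z] s0 sz by (intro measure_Un_le sets.Un pair) auto
    also have "measure \<pi> (E2 z \<union> {z} \<times> space ?M) \<le> measure \<pi> (E2 z) + measure \<pi> ({z} \<times> space ?M)"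
      using E2[OF z] sz by (intro measure_Un_le pair) auto
    finally have 2: "measure \<nu> (?D z) \<le> measure \<pi> (E2 z) + w z" unfolding wz m2[OF meas] out by simp
    have "0 \<le> measure \<pi> (E1 z)" "0 \<le> measure \<pi> (E2 z)" by simp_all
    with 1 2 show ?thesis by (simp only: abs_le_iff) linarith
  qed
  \<comment> \<open>A pair lies in at most one \<open>E1 z\<close>, since \<open>z\<close> must be
    \<open>x\<close>, and in at most one \<open>E2 z\<close>, since the balls are disjoint. The sum
    is therefore at most 2, while every such pair is at distance at least \<open>h / 2\<close>; this
    gives the factor \<open>h / 4\<close>.\<close>
  have cost: "h / 4 * (\<Sum>z\<in>Z. indicator (E1 z) (x, y) + indicator (E2 z) (x, y)) \<le> ?c x y" for x y
  proof (cases "\<exists>z\<in>Z. (x, y) \<in> E1 z \<union> E2 z")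
    case True
    then obtain z where z: "z \<in> Z" "(x, y) \<in> E1 z \<union> E2 z" by auto
    have far: "h / 2 \<le> ?c x y"
    proof (cases "(x, y) \<in> E1 z")
      case True then show ?thesis by (auto simp: E1_def near_def)
    next
      case False
      then have "x \<in> Z" "x \<noteq> z" "?c z y < h / 2" using z by (auto simp: E2_def near_def)
      then show ?thesis using sup_dist_Z[OF z(1), of x] sup_dist_triangle[of "{1..K}" d z x y]
        by (simp add: sup_dist_commute[of d _ x])
    qed
    have "(\<Sum>z\<in>Z. indicator (E1 z) (x, y)) \<le> (\<Sum>z\<in>Z. if z = x then 1 else 0 :: real)"
      by (rule sum_mono) (auto simp: E1_def indicator_def)
    also have "\<dots> \<le> 1" using finite_Z by simp
    finally have s1: "(\<Sum>z\<in>Z. indicator (E1 z) (x, y)) \<le> (1::real)" .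
    have s2: "(\<Sum>z\<in>Z. indicator (E2 z) (x, y)) \<le> (1::real)"
    proof (cases "\<exists>u\<in>Z. y \<in> ?D u")
      case True
      then obtain u where u: "u \<in> Z" "y \<in> ?D u" by auto
      have "z = u" if "z \<in> Z" "y \<in> ?D z" for z
      proof (rule ccontr)
        assume "z \<noteq> u"
        then have "h \<le> ?c z u" using sup_dist_Z u that by auto
        moreover have "?c z y < h / 2" "?c u y < h / 2" using that u by (auto simp: near_def)
        ultimately show False using sup_dist_triangle[of "{1..K}" d z u y]
          by (simp add: sup_dist_commute[of d _ y])
      qed
      then have "(\<Sum>z\<in>Z. indicator (E2 z) (x, y)) \<le> (\<Sum>z\<in>Z. if z = u then 1 else 0 :: real)"
        by (intro sum_mono) (auto simp: E2_def indicator_def)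
      also have "\<dots> \<le> 1" using finite_Z by simp
      finally show ?thesis .
    next
      case False
      then have "(\<Sum>z\<in>Z. indicator (E2 z) (x, y)) = (\<Sum>z\<in>Z. 0 :: real)"
        by (intro sum.cong) (auto simp: E2_def)
      then show ?thesis by simp
    qed
    have "h / 4 * (\<Sum>z\<in>Z. indicator (E1 z) (x, y) + indicator (E2 z) (x, y)) \<le> h / 4 * 2"
      using s1 s2 h_pos by (intro mult_left_mono) (auto simp: sum.distrib)
    then show ?thesis using far by simp
  next
    case False
    then have "(\<Sum>z\<in>Z. indicator (E1 z) (x, y) + indicator (E2 z) (x, y)) = (\<Sum>z\<in>Z. 0 :: real)"
      by (intro sum.cong) auto
    then show ?thesis by (simp add: sup_dist_nonneg)
  qed
  have int: "integrable \<pi> (\<lambda>p. indicator (E1 z) p + indicator (E2 z) p :: real)"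
    "integrable \<pi> (indicator (E1 z) :: _ \<Rightarrow> real)" "integrable \<pi> (indicator (E2 z) :: _ \<Rightarrow> real)"
    if "z \<in> Z" for z
    using E1[OF that] E2[OF that]
    by (auto intro!: Bochner_Integration.integrable_add integrable_real_indicator simp: less_top[symmetric])
  have "h / 4 * (\<Sum>z\<in>Z. \<bar>w z - measure \<nu> (?D z)\<bar>) \<le> h / 4 * (\<Sum>z\<in>Z. measure \<pi> (E1 z) + measure \<pi> (E2 z))"
    using h_pos dev by (intro mult_left_mono sum_mono) auto
  also have "\<dots> = (\<integral>p. h / 4 * (\<Sum>z\<in>Z. indicator (E1 z) p + indicator (E2 z) p) \<partial>\<pi>)"
  proof -
    have "(\<integral>p. (\<Sum>z\<in>Z. indicator (E1 z) p + indicator (E2 z) p) \<partial>\<pi>) =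
      (\<Sum>z\<in>Z. \<integral>p. indicator (E1 z) p + indicator (E2 z) p \<partial>\<pi> :: real)"
      by (rule Bochner_Integration.integral_sum[OF int(1)])
    also have "\<dots> = (\<Sum>z\<in>Z. measure \<pi> (E1 z) + measure \<pi> (E2 z))"
    proof (rule sum.cong[OF refl])
      fix z assume z: "z \<in> Z"
      have "E1 z \<inter> space \<pi> = E1 z" "E2 z \<inter> space \<pi> = E2 z"
        using sets.sets_into_space[OF E1[OF z]] sets.sets_into_space[OF E2[OF z]] by auto
      then show "(\<integral>p. indicator (E1 z) p + indicator (E2 z) p \<partial>\<pi>) = measure \<pi> (E1 z) + measure \<pi> (E2 z)"
        using int(2,3)[OF z] by (subst Bochner_Integration.integral_add) auto
    qed
    finally show ?thesis by simp
  qed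
  finally have "ennreal (h / 4 * (\<Sum>z\<in>Z. \<bar>w z - measure \<nu> (?D z)\<bar>)) \<le>
      ennreal (\<integral>p. h / 4 * (\<Sum>z\<in>Z. indicator (E1 z) p + indicator (E2 z) p) \<partial>\<pi>)"
    by (rule ennreal_leI)
  also have "\<dots> = (\<integral>\<^sup>+p. ennreal (h / 4 * (\<Sum>z\<in>Z. indicator (E1 z) p + indicator (E2 z) p)) \<partial>\<pi>)"
  proof (rule nn_integral_eq_integral[symmetric])
    show "integrable \<pi> (\<lambda>p. h / 4 * (\<Sum>z\<in>Z. indicator (E1 z) p + indicator (E2 z) p))"
      by (intro integrable_mult_right Bochner_Integration.integrable_sum int(1))
    show "AE p in \<pi>. 0 \<le> h / 4 * (\<Sum>z\<in>Z. indicator (E1 z) p + indicator (E2 z) p)"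
      using h_pos by (auto intro!: mult_nonneg_nonneg sum_nonneg)
  qed
  also have "\<dots> \<le> (\<integral>\<^sup>+ (x, y). ennreal (?c x y) \<partial>\<pi>)"
    using cost by (intro nn_integral_mono) (auto intro!: ennreal_leI split: prod.split)
  finally show "ennreal (h / 4 * (\<Sum>z\<in>Z. \<bar>w z - measure \<nu> (?D z)\<bar>)) \<le> (\<integral>\<^sup>+ (x, y). ennreal (?c x y) \<partial>\<pi>)" .
qed

text \<open>Comparing pointwise with a simple function supported on samples from the grid avoids the
  question whether the Wasserstein distance is measurable in the sample.\<close>

lemma risk_ge:
  fixes n :: nat
  assumes est: "est \<in> (\<Pi>\<^sub>M i\<in>{..<n}. cube d {1..K}) \<rightarrow>\<^sub>M prob_algebra (cube d {1..K})"
  shows "ennreal (h / 4 * (\<Sum>x\<in>{..<n} \<rightarrow>\<^sub>E Z. (\<Prod>i<n. w (x i)) *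
      (\<Sum>z\<in>Z. \<bar>w z - measure (est x) (near d {1..K} (h/2) z)\<bar>)))
    \<le> (\<integral>\<^sup>+ x. wasserstein d {1..K} law (est x) \<partial>(\<Pi>\<^sub>M i\<in>{..<n}. law))"
proof -
  let ?X = "{..<n} \<rightarrow>\<^sub>E Z" and ?P = "\<Pi>\<^sub>M i\<in>{..<n}. law"
  let ?l = "\<lambda>x. h / 4 * (\<Sum>z\<in>Z. \<bar>w z - measure (est x) (near d {1..K} (h/2) z)\<bar>)"
  interpret L: prob_space law using law_prob by (simp add: space_prob_algebra)
  interpret product_sigma_finite "\<lambda>_. law" ..
  have finX: "finite ?X" using finite_Z by (intro finite_PiE) auto
  have l0: "0 \<le> ?l x" for x using h_pos by (intro mult_nonneg_nonneg sum_nonneg) auto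
  have single: "{x} \<in> sets ?P" "emeasure ?P {x} = ennreal (\<Prod>i<n. w (x i))" if x: "x \<in> ?X" for x
  proof -
    have eq: "{x} = (\<Pi>\<^sub>E i\<in>{..<n}. {x i})"
      using x by (subst PiE_singleton) (auto simp: PiE_def)
    have s: "{x i} \<in> sets law" if "i < n" for i
      using x that sets_Z[of "{x i}"] by (auto simp: PiE_def Pi_def)
    show "{x} \<in> sets ?P" unfolding eq using s by (intro sets_PiM_I_finite) auto
    have "emeasure ?P {x} = (\<Prod>i<n. emeasure law {x i})"
      unfolding eq using s by (intro emeasure_PiM) auto
    also have "\<dots> = (\<Prod>i<n. ennreal (w (x i)))"
      using x by (intro prod.cong refl emeasure_law_singleton) auto
    also have "\<dots> = ennreal (\<Prod>i<n. w (x i))"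
      using x by (intro prod_ennreal w_nonneg) auto
    finally show "emeasure ?P {x} = ennreal (\<Prod>i<n. w (x i))" .
  qed
  have "ennreal (h / 4 * (\<Sum>x\<in>?X. (\<Prod>i<n. w (x i)) *
      (\<Sum>z\<in>Z. \<bar>w z - measure (est x) (near d {1..K} (h/2) z)\<bar>))) = ennreal (\<Sum>x\<in>?X. ?l x * (\<Prod>i<n. w (x i)))"
    by (simp add: sum_distrib_left mult_ac)
  also have "\<dots> = (\<Sum>x\<in>?X. ennreal (?l x * (\<Prod>i<n. w (x i))))"
    by (intro sum_ennreal[symmetric] mult_nonneg_nonneg[OF l0] prod_nonneg ballI w_nonneg) auto
  also have "\<dots> = (\<Sum>x\<in>?X. ennreal (?l x) * emeasure ?P {x})"
  proof (rule sum.cong[OF refl])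
    fix x assume x: "x \<in> ?X"
    then have "0 \<le> (\<Prod>i<n. w (x i))" by (intro prod_nonneg ballI w_nonneg) auto
    then show "ennreal (?l x * (\<Prod>i<n. w (x i))) = ennreal (?l x) * emeasure ?P {x}"
      using l0[of x] unfolding single(2)[OF x] by (rule ennreal_mult[rotated])
  qed
  also have "\<dots> = (\<Sum>x\<in>?X. \<integral>\<^sup>+y. ennreal (?l x) * indicator {x} y \<partial>?P)"
    by (intro sum.cong refl nn_integral_cmult_indicator[symmetric] single(1))
  also have "\<dots> = (\<integral>\<^sup>+y. (\<Sum>x\<in>?X. ennreal (?l x) * indicator {x} y) \<partial>?P)"
    using single(1) by (intro nn_integral_sum[symmetric]) auto
  also have "\<dots> \<le> (\<integral>\<^sup>+ x. wasserstein d {1..K} law (est x) \<partial>?P)"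
  proof (rule nn_integral_mono)
    fix y assume "y \<in> space ?P"
    then have y: "y \<in> space (\<Pi>\<^sub>M i\<in>{..<n}. cube d {1..K})" by (simp add: space_PiM)
    have "(\<Sum>x\<in>?X. ennreal (?l x) * indicator {x} y) = (\<Sum>x\<in>?X. if x = y then ennreal (?l y) else 0)"
      by (rule sum.cong) auto
    also have "\<dots> \<le> ennreal (?l y)" using finX by simp
    also have "\<dots> \<le> wasserstein d {1..K} law (est y)"
      by (rule wasserstein_ge[OF measurable_space[OF est y]])
    finally show "(\<Sum>x\<in>?X. ennreal (?l x) * indicator {x} y) \<le> wasserstein d {1..K} law (est y)" .
  qed
  finally show ?thesis .
qed

end

subsection \<open>Assouad's lemma for paired weights\<close>

text \<open>Le Cam's inequality between affinity and overlap: \<open>P x * Q x\<close> is the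
  product of minimum and maximum, so Cauchy-Schwarz applies, and the maxima sum to at most
  2.\<close>

lemma sum_min_ge_affinity:
  fixes P Q :: "'a \<Rightarrow> real"
  assumes "\<And>x. x \<in> X \<Longrightarrow> 0 \<le> P x" "\<And>x. x \<in> X \<Longrightarrow> 0 \<le> Q x" "sum P X = 1" "sum Q X = 1"
  shows "(\<Sum>x\<in>X. sqrt (P x * Q x))\<^sup>2 / 2 \<le> (\<Sum>x\<in>X. min (P x) (Q x))"
proof -
  have "(\<Sum>x\<in>X. sqrt (P x * Q x)) = (\<Sum>x\<in>X. sqrt (min (P x) (Q x)) * sqrt (max (P x) (Q x)))"
    by (rule sum.cong) (auto simp: min_def max_def real_sqrt_mult)
  then have "(\<Sum>x\<in>X. sqrt (P x * Q x))\<^sup>2 \<le>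
      (\<Sum>x\<in>X. (sqrt (min (P x) (Q x)))\<^sup>2) * (\<Sum>x\<in>X. (sqrt (max (P x) (Q x)))\<^sup>2)"
    using Cauchy_Schwarz_ineq_sum[of "\<lambda>x. sqrt (min (P x) (Q x))" "\<lambda>x. sqrt (max (P x) (Q x))" X] by simp
  also have "\<dots> = (\<Sum>x\<in>X. min (P x) (Q x)) * (\<Sum>x\<in>X. max (P x) (Q x))"
    using assms by (intro arg_cong2[where f="(*)"] sum.cong refl) (auto simp: min_def max_def)
  also have "\<dots> \<le> (\<Sum>x\<in>X. min (P x) (Q x)) * 2"
  proof (rule mult_left_mono)
    have "(\<Sum>x\<in>X. max (P x) (Q x)) \<le> (\<Sum>x\<in>X. P x + Q x)"
      using assms by (intro sum_mono) auto
    then show "(\<Sum>x\<in>X. max (P x) (Q x)) \<le> 2" using assms by (simp add: sum.distrib)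
    show "0 \<le> (\<Sum>x\<in>X. min (P x) (Q x))" using assms by (intro sum_nonneg) auto
  qed
  finally show ?thesis by simp
qed

lemma sum_PiE_power:
  fixes f :: "'a \<Rightarrow> real"
  assumes "finite Z" shows "(\<Sum>x\<in>{..<n} \<rightarrow>\<^sub>E Z. \<Prod>i<n. f (x i)) = (sum f Z) ^ n"
  using prod_sum_PiE[of "{..<n}" "\<lambda>_. Z" "\<lambda>_. f"] assms by simp

text \<open>The affinity is multiplicative over independent observations. Bernoulli's inequality
  keeps the square of the affinity of the product laws above 1/2, so their overlap is at least 1/4;
  on the overlap, \<open>T x\<close> cannot be close to both \<open>a\<close> and
  \<open>b\<close>.\<close>

lemma two_point_bound:
  fixes u v :: "'a \<Rightarrow> real" and T :: "(nat \<Rightarrow> 'a) \<Rightarrow> real"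
  assumes "finite Z" and u: "\<And>z. z \<in> Z \<Longrightarrow> 0 \<le> u z" "sum u Z = 1" and v: "\<And>z. z \<in> Z \<Longrightarrow> 0 \<le> v z" "sum v Z = 1"
    and rho: "1 - \<delta> \<le> (\<Sum>z\<in>Z. sqrt (u z * v z))" and delta: "0 \<le> \<delta>" "\<delta> \<le> 1" "4 * real n * \<delta> \<le> 1"
  shows "\<bar>a - b\<bar> / 4 \<le> (\<Sum>x\<in>{..<n} \<rightarrow>\<^sub>E Z. (\<Prod>i<n. u (x i)) * \<bar>a - T x\<bar>) +
    (\<Sum>x\<in>{..<n} \<rightarrow>\<^sub>E Z. (\<Prod>i<n. v (x i)) * \<bar>b - T x\<bar>)"
proof -
  let ?X = "{..<n} \<rightarrow>\<^sub>E Z" and ?P = "\<lambda>x. \<Prod>i<n. u (x i)" and ?Q = "\<lambda>x. \<Prod>i<n. v (x i)"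
  have PQ: "0 \<le> ?P x" "0 \<le> ?Q x" if "x \<in> ?X" for x
    using that u v by (auto intro!: prod_nonneg)
  have "1 / 2 \<le> 1 + real (2 * n) * (- \<delta>)" using delta by simp
  also have "\<dots> \<le> (1 + (- \<delta>)) ^ (2 * n)" using delta by (intro Bernoulli_inequality) auto
  also have "\<dots> \<le> (\<Sum>z\<in>Z. sqrt (u z * v z)) ^ (2 * n)"
    using rho delta by (intro power_mono) auto
  also have "\<dots> = ((\<Sum>z\<in>Z. sqrt (u z * v z)) ^ n)\<^sup>2"
    by (simp add: power_mult[symmetric] mult.commute)
  also have "(\<Sum>z\<in>Z. sqrt (u z * v z)) ^ n = (\<Sum>x\<in>?X. \<Prod>i<n. sqrt (u (x i) * v (x i)))"
    by (rule sum_PiE_power[OF assms(1), symmetric])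
  also have "\<dots> = (\<Sum>x\<in>?X. sqrt (?P x * ?Q x))"
  proof (rule sum.cong[OF refl])
    have "(\<Prod>i<m. sqrt (u (x i) * v (x i))) = sqrt ((\<Prod>i<m. u (x i)) * (\<Prod>i<m. v (x i)))" for x and m :: nat
      by (induction m) (simp_all add: real_sqrt_mult)
    then show "(\<Prod>i<n. sqrt (u (x i) * v (x i))) = sqrt (?P x * ?Q x)" for x .
  qed
  finally have "1 / 4 \<le> (\<Sum>x\<in>?X. sqrt (?P x * ?Q x))\<^sup>2 / 2" by simp
  also have "\<dots> \<le> (\<Sum>x\<in>?X. min (?P x) (?Q x))"
    using PQ u v by (intro sum_min_ge_affinity) (auto simp: sum_PiE_power[OF assms(1)])
  finally have "\<bar>a - b\<bar> * (1 / 4) \<le> \<bar>a - b\<bar> * (\<Sum>x\<in>?X. min (?P x) (?Q x))"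
    by (intro mult_left_mono) auto
  also have "\<dots> \<le> (\<Sum>x\<in>?X. ?P x * \<bar>a - T x\<bar> + ?Q x * \<bar>b - T x\<bar>)"
    unfolding sum_distrib_left
  proof (rule sum_mono)
    fix x assume x: "x \<in> ?X"
    have "\<bar>a - b\<bar> * min (?P x) (?Q x) \<le> (\<bar>a - T x\<bar> + \<bar>b - T x\<bar>) * min (?P x) (?Q x)"
      using PQ[OF x] by (intro mult_right_mono) auto
    also have "\<dots> = min (?P x) (?Q x) * \<bar>a - T x\<bar> + min (?P x) (?Q x) * \<bar>b - T x\<bar>"
      by (simp add: algebra_simps)
    also have "\<dots> \<le> ?P x * \<bar>a - T x\<bar> + ?Q x * \<bar>b - T x\<bar>"
      by (intro add_mono mult_right_mono) auto
    finally show "\<bar>a - b\<bar> * min (?P x) (?Q x) \<le> ?P x * \<bar>a - T x\<bar> + ?Q x * \<bar>b - T x\<bar>" .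
  qed
  finally show ?thesis by (simp add: sum.distrib)
qed

text \<open>\<open>E\<close> and \<open>insert z E\<close> are the ends of an edge of the cube of
  subsets in direction \<open>z\<close>; Assouad's argument averages over these edges.\<close>

lemma sum_Pow_split:
  fixes f :: "'a set \<Rightarrow> real"
  assumes "finite S" "z \<in> S"
  shows "(\<Sum>E\<in>Pow S. f E) = (\<Sum>E\<in>Pow (S - {z}). f E + f (insert z E))"
proof -
  have "Pow S = Pow (S - {z}) \<union> insert z ` Pow (S - {z})"
    using Pow_insert[of z "S - {z}"] assms by (simp add: insert_absorb)
  moreover have "Pow (S - {z}) \<inter> insert z ` Pow (S - {z}) = {}" by auto
  moreover have "inj_on (insert z) (Pow (S - {z}))" by (auto simp: inj_on_def)
  ultimately show ?thesis
    using assms by (simp add: sum.union_disjoint sum.reindex sum.distrib)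
qed

text \<open>The points of \<open>Z\<close> come in pairs \<open>z, F z\<close> with \<open>z \<in> Z\<^sub>0\<close>. The set \<open>E \<subseteq> Z\<^sub>0\<close> says which pairs
  move a fraction \<open>\<alpha>\<close> of the uniform mass from \<open>F z\<close> to \<open>z\<close> rather than back.\<close>

locale paired_weights =
  fixes Z Z0 :: "'a set" and F F' :: "'a \<Rightarrow> 'a" and \<alpha> :: real
  assumes finite_Z0: "finite Z0" and Z0_ne: "Z0 \<noteq> {}"
    and F': "\<And>z. z \<in> Z0 \<Longrightarrow> F' (F z) = z" and F_notin: "\<And>z. z \<in> Z0 \<Longrightarrow> F z \<notin> Z0"
    and Z: "Z = Z0 \<union> F ` Z0" and alpha: "0 < \<alpha>" "\<alpha> < 1"
begin

definition tilt :: "'a set \<Rightarrow> 'a \<Rightarrow> real" where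
  "tilt E z = (if z \<in> E then 1 + \<alpha> else 1 - \<alpha>)"

definition weight :: "'a set \<Rightarrow> 'a \<Rightarrow> real" where
  "weight E z = (if z \<in> Z0 then tilt E z else 2 - tilt E (F' z)) / card Z"

lemma sum_Z: "(\<Sum>z\<in>Z. g z) = (\<Sum>z\<in>Z0. g z + g (F z))" for g :: "'a \<Rightarrow> real"
proof -
  have "Z0 \<inter> F ` Z0 = {}" using F_notin by auto
  moreover have "inj_on F Z0" using F' by (rule inj_on_inverseI)
  ultimately show ?thesis
    unfolding Z using finite_Z0 by (simp add: sum.union_disjoint sum.reindex sum.distrib)
qed

lemma finite_pairs: "finite Z" using finite_Z0 Z by simp

lemma card_Z: "real (card Z) = 2 * real (card Z0)"
  using sum_Z[of "\<lambda>_. 1"] by simp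

lemma card_Z_pos: "0 < real (card Z)"
  using Z0_ne finite_Z0 by (simp add: card_Z card_gt_0_iff)

lemma weight_bounds: "(1 - \<alpha>) / card Z \<le> weight E z" "weight E z \<le> (1 + \<alpha>) / card Z"
  unfolding weight_def tilt_def using alpha by (auto intro!: divide_right_mono)

lemma weight_pos: "0 < weight E z"
  using weight_bounds(1)[of E z] alpha card_Z_pos
  by (meson diff_gt_0_iff_gt divide_pos_pos less_le_trans)

lemma sum_weight: "sum (weight E) Z = 1"
proof -
  have "sum (weight E) Z = (\<Sum>z\<in>Z0. 2 / card Z)"
    unfolding sum_Z by (rule sum.cong) (simp_all add: weight_def F' F_notin add_divide_distrib[symmetric])
  then show ?thesis using card_Z card_Z_pos by simp
qed

text \<open>The two laws differ only at \<open>z\<close> and \<open>F z\<close>, where the factors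
  \<open>1 + \<alpha>\<close> and \<open>1 - \<alpha>\<close> are exchanged. Each of these points
  loses at most \<open>\<alpha>\<^sup>2 / card Z\<close>, because a number in [0,1] is at most its
  square root.\<close>

lemma affinity:
  assumes z: "z \<in> Z0" "z \<notin> E"
  shows "1 - 2 * \<alpha>\<^sup>2 / card Z \<le> (\<Sum>y\<in>Z. sqrt (weight E y * weight (insert z E) y))"
proof -
  have a: "0 \<le> 1 - \<alpha>\<^sup>2" "1 - \<alpha>\<^sup>2 \<le> 1" using alpha by (auto simp: power_le_one)
  have s: "1 - \<alpha>\<^sup>2 \<le> sqrt ((1 + \<alpha>) * (1 - \<alpha>))"
  proof -
    have "(1 - \<alpha>\<^sup>2)\<^sup>2 \<le> 1 - \<alpha>\<^sup>2" using a by (simp add: power2_eq_square mult_left_le)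
    then have "1 - \<alpha>\<^sup>2 \<le> sqrt (1 - \<alpha>\<^sup>2)" by (rule real_le_rsqrt)
    then show ?thesis by (simp add: algebra_simps power2_eq_square)
  qed
  have "1 - 2 * \<alpha>\<^sup>2 / card Z = (\<Sum>y\<in>Z0. 2 / card Z - (if y = z then 2 * \<alpha>\<^sup>2 / card Z else 0))"
    using z(1) finite_Z0 card_Z card_Z_pos by (auto simp: sum_subtractf)
  also have "\<dots> \<le> (\<Sum>y\<in>Z0. sqrt (weight E y * weight (insert z E) y) + sqrt (weight E (F y) * weight (insert z E) (F y)))"
  proof (rule sum_mono)
    fix y assume y: "y \<in> Z0"
    have q: "sqrt (p / (real (card Z) * real (card Z))) = sqrt p / card Z" for p
      using card_Z_pos by (simp add: real_sqrt_mult real_sqrt_divide)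
    have t: "tilt E y > 0" "2 - tilt E y > 0" using alpha by (auto simp: tilt_def)
    show "2 / card Z - (if y = z then 2 * \<alpha>\<^sup>2 / card Z else 0) \<le>
      sqrt (weight E y * weight (insert z E) y) + sqrt (weight E (F y) * weight (insert z E) (F y))"
    proof (cases "y = z")
      case True
      have "2 / card Z - 2 * \<alpha>\<^sup>2 / card Z = (1 - \<alpha>\<^sup>2) / card Z + (1 - \<alpha>\<^sup>2) / card Z"
        by (simp add: diff_divide_distrib)
      also have "\<dots> \<le> sqrt ((1 + \<alpha>) * (1 - \<alpha>)) / card Z + sqrt ((1 + \<alpha>) * (1 - \<alpha>)) / card Z"
        using s by (intro add_mono divide_right_mono) auto
      finally show ?thesis
        using True z by (simp add: weight_def F' F_notin tilt_def q mult.commute)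
    next
      case False
      then have "tilt (insert z E) y = tilt E y" by (simp add: tilt_def)
      then show ?thesis
        using False y t by (simp add: weight_def F' F_notin q diff_divide_distrib)
    qed
  qed
  also have "\<dots> = (\<Sum>y\<in>Z. sqrt (weight E y * weight (insert z E) y))"
    by (rule sum_Z[symmetric])
  finally show ?thesis .
qed

text \<open>The mean over all subsets of \<open>Z0\<close> is at least \<open>\<alpha> / 8\<close>:
  each edge in direction \<open>z\<close> contributes a quarter of the gap
  \<open>2 * \<alpha> / card Z\<close> between the two weights of \<open>z\<close>, there are half
  as many such edges as subsets, and \<open>Z0\<close> is half of \<open>Z\<close>.\<close>

lemma assouad:
  fixes T :: "(nat \<Rightarrow> 'a) \<Rightarrow> 'a \<Rightarrow> real"
  assumes n: "8 * real n * \<alpha>\<^sup>2 \<le> card Z"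
  shows "\<exists>E. \<alpha> / 8 \<le> (\<Sum>x\<in>{..<n} \<rightarrow>\<^sub>E Z. (\<Prod>i<n. weight E (x i)) * (\<Sum>z\<in>Z. \<bar>weight E z - T x z\<bar>))"
proof (rule ccontr)
  assume "\<not> ?thesis"
  then have small: "(\<Sum>x\<in>{..<n} \<rightarrow>\<^sub>E Z. (\<Prod>i<n. weight E (x i)) * (\<Sum>z\<in>Z. \<bar>weight E z - T x z\<bar>)) < \<alpha> / 8" for E
    by (auto simp: not_le)
  define R where "R E z = (\<Sum>x\<in>{..<n} \<rightarrow>\<^sub>E Z. (\<Prod>i<n. weight E (x i)) * \<bar>weight E z - T x z\<bar>)" for E z
  have card: "2 \<le> real (card Z)" using Z0_ne finite_Z0 by (simp add: card_Z Suc_le_eq card_gt_0_iff)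
  have R_pair: "\<alpha> / (2 * card Z) \<le> R E z + R (insert z E) z" if "z \<in> Z0" "z \<notin> E" for E z
  proof -
    have diff: "\<bar>weight E z - weight (insert z E) z\<bar> = 2 * \<alpha> / card Z"
    proof -
      have "weight E z - weight (insert z E) z = - (2 * \<alpha> / card Z)"
        using that by (simp add: weight_def tilt_def diff_divide_distrib[symmetric])
      then show ?thesis using alpha by simp
    qed
    have "\<bar>weight E z - weight (insert z E) z\<bar> / 4 \<le> R E z + R (insert z E) z"
      unfolding R_def
    \<comment> \<open>Here \<open>\<delta>\<close> is \<open>2 * \<alpha>\<^sup>2 / card Z\<close>,
      so that \<open>4 * real n * \<delta> \<le> 1\<close> is the hypothesis
      \<open>n\<close>.\<close>
    proof (rule two_point_bound[OF finite_pairs _ sum_weight _ sum_weight affinity[OF that]])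
      show "0 \<le> 2 * \<alpha>\<^sup>2 / card Z" by simp
      have "\<alpha>\<^sup>2 \<le> 1" using alpha by (simp add: power_le_one)
      then show "2 * \<alpha>\<^sup>2 / card Z \<le> 1" using card by (simp add: field_simps)
      show "4 * real n * (2 * \<alpha>\<^sup>2 / card Z) \<le> 1" using n card by (simp add: field_simps)
    qed (use weight_pos in \<open>auto intro: less_imp_le\<close>)
    then show ?thesis by (simp add: diff)
  qed
  have "(\<Sum>E\<in>Pow Z0. \<Sum>z\<in>Z0. R E z) = (\<Sum>z\<in>Z0. \<Sum>E\<in>Pow (Z0 - {z}). R E z + R (insert z E) z)"
    unfolding sum.swap[of "\<lambda>E z. R E z"] using finite_Z0 by (intro sum.cong refl sum_Pow_split)
  also have "\<dots> \<ge> (\<Sum>z\<in>Z0. \<Sum>E\<in>Pow (Z0 - {z}). \<alpha> / (2 * card Z))"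
    by (intro sum_mono R_pair) auto
  also have "(\<Sum>z\<in>Z0. \<Sum>E\<in>Pow (Z0 - {z}). \<alpha> / (2 * card Z)) = (\<Sum>z\<in>Z0. 2 ^ card Z0 / 2 * (\<alpha> / (2 * card Z)))"
  proof (rule sum.cong[OF refl])
    fix z assume "z \<in> Z0"
    then have "card Z0 = Suc (card (Z0 - {z}))" using finite_Z0 by (metis card.remove)
    then show "(\<Sum>E\<in>Pow (Z0 - {z}). \<alpha> / (2 * card Z)) = 2 ^ card Z0 / 2 * (\<alpha> / (2 * card Z))"
      using finite_Z0 by (simp add: card_Pow)
  qed
  also have "\<dots> = 2 ^ card Z0 * (\<alpha> / 8)"
    using card_Z card_Z_pos by (simp add: field_simps)
  finally have "2 ^ card Z0 * (\<alpha> / 8) \<le> (\<Sum>E\<in>Pow Z0. \<Sum>z\<in>Z0. R E z)" .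
  also have "\<dots> < (\<Sum>E\<in>Pow Z0. \<alpha> / 8)"
  proof (rule sum_strict_mono)
    fix E
    have "(\<Sum>z\<in>Z0. R E z) = (\<Sum>x\<in>{..<n} \<rightarrow>\<^sub>E Z. (\<Prod>i<n. weight E (x i)) * (\<Sum>z\<in>Z0. \<bar>weight E z - T x z\<bar>))"
      unfolding R_def sum_distrib_left by (rule sum.swap)
    also have "\<dots> \<le> (\<Sum>x\<in>{..<n} \<rightarrow>\<^sub>E Z. (\<Prod>i<n. weight E (x i)) * (\<Sum>z\<in>Z. \<bar>weight E z - T x z\<bar>))"
      using finite_pairs Z weight_pos
      by (intro sum_mono mult_left_mono sum_mono2 prod_nonneg) (auto intro: less_imp_le)
    finally show "(\<Sum>z\<in>Z0. R E z) < \<alpha> / 8" using small[of E] by simp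
  qed (use finite_Z0 in auto)
  finally show False using finite_Z0 by (simp add: card_Pow)
qed

end

subsection \<open>Perturbed uniform laws on grids\<close>

context grid_law
begin

text \<open>Replacing the \<open>A\<close>-coordinates of \<open>z\<close> by those of \<open>y\<close> identifies the fibre of \<open>x\<close> with the
  fibre of \<open>y\<close> without changing the \<open>B\<close>-coordinates, so the two conditional laws have almost the
  same weights.\<close>

lemma cond_mean_diff_le:
  assumes AB: "A \<inter> B = {}" "B \<subseteq> {1..K}"
    and closed: "\<And>x y. x \<in> Z \<Longrightarrow> y \<in> Z \<Longrightarrow> override_on x y (coords d A) \<in> Z"
    and lo: "0 < lo" and bounds: "\<And>z. z \<in> Z \<Longrightarrow> lo \<le> w z" "\<And>z. z \<in> Z \<Longrightarrow> w z \<le> hi"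
    and f: "\<And>b. b \<in> space (cube d B) \<Longrightarrow> \<bar>f b\<bar> \<le> 1/2" and xy: "x \<in> Z" "y \<in> Z"
  shows "\<bar>cond_mean A (\<lambda>z. f (proj d B z)) (proj d A x) - cond_mean A (\<lambda>z. f (proj d B z)) (proj d A y)\<bar>
    \<le> (hi / lo - lo / hi) / 2"
proof -
  define fib where "fib x = {z \<in> Z. proj d A z = proj d A x}" for x
  have fin: "finite (fib x)" for x using finite_Z by (simp add: fib_def)
  let ?o = "\<lambda>u z. override_on z u (coords d A)"
  have disj: "coords d A \<inter> coords d B = {}" by (rule coords_disjoint[OF AB(1)])
  have proj_o: "proj d A (?o u z) = proj d A u" "proj d B (?o u z) = proj d B z" for u z
    using disj by (auto simp: proj_def override_on_def fun_eq_iff)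
  have o_o: "?o u (?o v z) = z" if "z \<in> fib u" for u v z
  proof
    fix j
    have "proj d A z j = proj d A u j" using that by (simp add: fib_def)
    then show "?o u (?o v z) j = z j" by (auto simp: proj_def override_on_def split: if_splits)
  qed
  have mem: "?o u z \<in> fib u" if "u \<in> Z" "z \<in> Z" for u z
    using closed[OF that(2,1)] by (simp add: fib_def proj_o)
  have bij: "bij_betw (?o y) (fib x) (fib y)"
    by (rule bij_betwI[of _ _ _ "?o x"]) (use mem xy o_o in \<open>auto simp: fib_def\<close>)
  let ?N = "real (card (fib x))"
  have "x \<in> fib x" using xy by (simp add: fib_def)
  then have N: "0 < ?N" using fin by (auto simp: card_gt_0_iff)
  have cN: "card (fib y) = card (fib x)" using bij_betw_same_card[OF bij] by simp
  have hi: "0 < hi" "lo \<le> hi" using bounds[OF xy(1)] lo by auto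
  have m: "?N * lo \<le> mass A (proj d A u)" "mass A (proj d A u) \<le> ?N * hi" if "card (fib u) = card (fib x)" for u
    using sum_bounded_below[of "fib u" lo w] sum_bounded_above[of "fib u" w hi] bounds that
    by (auto simp: mass_def fib_def)
  \<comment> \<open>Both fibres have size \<open>?N\<close>, so all conditional weights obey the
    same two bounds, and \<open>?N\<close> cancels once they are summed over a fibre.\<close>
  have ratio: "lo / (?N * hi) \<le> w z / mass A (proj d A u)" "w z / mass A (proj d A u) \<le> hi / (?N * lo)"
    if "z \<in> Z" "card (fib u) = card (fib x)" for u z
  proof -
    have p: "0 < ?N * lo" using N lo by simp
    show "lo / (?N * hi) \<le> w z / mass A (proj d A u)"
      using m[OF that(2)] p lo bounds[OF that(1)] by (intro frac_le) auto
    show "w z / mass A (proj d A u) \<le> hi / (?N * lo)"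
      using m[OF that(2)] p lo hi bounds[OF that(1)] by (intro frac_le) auto
  qed
  have cm: "cond_mean A (\<lambda>z. f (proj d B z)) (proj d A u) = (\<Sum>z\<in>fib u. w z / mass A (proj d A u) * f (proj d B z))" for u
    by (simp add: cond_mean_def fib_def sum_divide_distrib)
  have "(\<Sum>z\<in>fib y. w z / mass A (proj d A y) * f (proj d B z)) =
      (\<Sum>z\<in>fib x. w (?o y z) / mass A (proj d A y) * f (proj d B z))"
    by (subst sum.reindex_bij_betw[OF bij, symmetric]) (simp add: proj_o)
  then have diff: "cond_mean A (\<lambda>z. f (proj d B z)) (proj d A x) - cond_mean A (\<lambda>z. f (proj d B z)) (proj d A y) =
      (\<Sum>z\<in>fib x. (w z / mass A (proj d A x) - w (?o y z) / mass A (proj d A y)) * f (proj d B z))"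
    by (simp add: cm sum_subtractf left_diff_distrib)
  have "\<bar>\<Sum>z\<in>fib x. (w z / mass A (proj d A x) - w (?o y z) / mass A (proj d A y)) * f (proj d B z)\<bar>
      \<le> (\<Sum>z\<in>fib x. \<bar>(w z / mass A (proj d A x) - w (?o y z) / mass A (proj d A y)) * f (proj d B z)\<bar>)"
    by (rule sum_abs)
  also have "\<dots> \<le> (\<Sum>z\<in>fib x. (hi / (?N * lo) - lo / (?N * hi)) * (1/2))"
  proof (rule sum_mono)
    fix z assume z: "z \<in> fib x"
    then have zZ: "z \<in> Z" "?o y z \<in> Z" using closed xy by (auto simp: fib_def)
    have "\<bar>w z / mass A (proj d A x) - w (?o y z) / mass A (proj d A y)\<bar> \<le> hi / (?N * lo) - lo / (?N * hi)"
      using ratio[OF zZ(1) refl] ratio[OF zZ(2) cN] by (simp only: abs_le_iff) linarith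
    moreover have "\<bar>f (proj d B z)\<bar> \<le> 1/2" using proj_Z[OF AB(2)] zZ by (intro f) auto
    ultimately show "\<bar>(w z / mass A (proj d A x) - w (?o y z) / mass A (proj d A y)) * f (proj d B z)\<bar>
      \<le> (hi / (?N * lo) - lo / (?N * hi)) * (1/2)"
      unfolding abs_mult by (intro mult_mono) auto
  qed
  also have "\<dots> = (hi / lo - lo / hi) / 2"
    using N lo hi by (simp add: field_simps)
  finally show ?thesis unfolding diff .
qed

lemma TV_Lipschitz_law:
  assumes G: "\<And>k. k \<in> {1..K} \<Longrightarrow> pa G k \<subseteq> {1..<k}"
    and cond: "\<And>A B. A \<subseteq> {1..K} \<Longrightarrow> B \<subseteq> {1..K} \<Longrightarrow> A \<inter> B = {} \<Longrightarrow> TV_Lipschitz_cond d L law B A"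
  shows "TV_Lipschitz K G d L law"
  unfolding TV_Lipschitz_def
proof
  fix k assume "k \<in> {2..K}"
  then have k: "k \<in> {1..K}" by auto
  then have "{1..<k} \<subseteq> {1..K}" by auto
  with G[OF k] have p: "pa G k \<subseteq> {1..K}" "pre G k \<subseteq> {1..K}" "k \<notin> pa G k" "pa G k \<inter> pre G k = {}"
    by (auto simp: pre_def)
  then show "TV_Lipschitz_cond d L law {k} (pa G k) \<and> TV_Lipschitz_cond d L law (pre G k) (pa G k) \<and>
      TV_Lipschitz_cond d L law (pa G k) {k}"
    using k by (intro conjI cond) auto
qed

end

text \<open>The nodes in \<open>S\<close> are spread over a grid of mesh \<open>1/(2m)\<close>, the others are frozen at \<open>0\<close>. The
  pairs of the perturbation are neighbours in the first coordinate of the node \<open>k\<^sub>0\<close>.\<close>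

locale perturbed_grid =
  fixes d :: "nat \<Rightarrow> nat" and K :: nat and S :: "nat set" and m k0 :: nat and \<alpha> :: real
  assumes S: "S \<subseteq> {1..K}" "k0 \<in> S" and d_k0: "1 \<le> d k0" and m: "1 \<le> m" and \<alpha>: "0 < \<alpha>" "\<alpha> < 1"
begin

text \<open>The number \<open>2 * m\<close> of levels is even, so that neighbours can be paired; the
  levels stop one step short of 1.\<close>

definition levels :: "nat \<times> nat \<Rightarrow> real set" where
  "levels j = (if fst j \<in> S then (\<lambda>i. real i / (2 * real m)) ` {..<2 * m} else {0})"

definition even_levels :: "nat \<times> nat \<Rightarrow> real set" where
  "even_levels j = (if j = (k0, 0) then (\<lambda>i. real (2 * i) / (2 * real m)) ` {..<m} else levels j)"

definition pts :: "(nat \<times> nat \<Rightarrow> real) set" where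
  "pts = (\<Pi>\<^sub>E j\<in>coords d {1..K}. levels j)"

definition even_pts :: "(nat \<times> nat \<Rightarrow> real) set" where
  "even_pts = (\<Pi>\<^sub>E j\<in>coords d {1..K}. even_levels j)"

definition shift :: "real \<Rightarrow> (nat \<times> nat \<Rightarrow> real) \<Rightarrow> nat \<times> nat \<Rightarrow> real" where
  "shift c z = z((k0, 0) := z (k0, 0) + c)"

lemma k0_coord: "(k0, 0) \<in> coords d {1..K}"
  using S d_k0 by (auto simp: coords_def)

lemma finite_levels: "finite (levels j)" "finite (even_levels j)"
  by (auto simp: levels_def even_levels_def)

lemma levels_k0:
  "levels (k0, 0) = even_levels (k0, 0) \<union> (\<lambda>t. t + 1 / (2 * real m)) ` even_levels (k0, 0)"
  "even_levels (k0, 0) \<inter> (\<lambda>t. t + 1 / (2 * real m)) ` even_levels (k0, 0) = {}"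
proof -
  have odd: "(\<lambda>t. t + 1 / (2 * real m)) ` even_levels (k0, 0) = (\<lambda>i. real (2 * i + 1) / (2 * real m)) ` {..<m}"
    by (simp add: even_levels_def image_image add_divide_distrib add.commute)
  have "{..<2 * m} = (\<lambda>i. 2 * i) ` {..<m} \<union> (\<lambda>i. 2 * i + 1) ` {..<m}"
  proof (intro equalityI subsetI)
    fix i assume "i \<in> {..<2 * m}"
    then show "i \<in> (\<lambda>i. 2 * i) ` {..<m} \<union> (\<lambda>i. 2 * i + 1) ` {..<m}"
      by (cases "even i") (auto elim!: evenE oddE)
  qed auto
  then show "levels (k0, 0) = even_levels (k0, 0) \<union> (\<lambda>t. t + 1 / (2 * real m)) ` even_levels (k0, 0)"
    unfolding odd using S by (simp add: levels_def even_levels_def image_Un image_image)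
  show "even_levels (k0, 0) \<inter> (\<lambda>t. t + 1 / (2 * real m)) ` even_levels (k0, 0) = {}"
    unfolding odd
  proof (rule equals0I)
    fix t assume "t \<in> even_levels (k0, 0) \<inter> (\<lambda>i. real (2 * i + 1) / (2 * real m)) ` {..<m}"
    then obtain i i' :: nat where "real (2 * i) / (2 * real m) = real (2 * i' + 1) / (2 * real m)"
      by (auto simp: even_levels_def)
    then have "real (2 * i) = real (2 * i' + 1)" using m by (simp add: field_simps)
    then have "2 * i = 2 * i' + 1" by (simp only: of_nat_eq_iff)
    then show False by presburger
  qed
qed

text \<open>The part of membership that \<open>pts\<close> and \<open>even_pts\<close> share and
  that \<open>shift\<close> leaves alone; what remains is a question about the single coordinate
  \<open>(k0, 0)\<close>.\<close>

definition rest :: "(nat \<times> nat \<Rightarrow> real) \<Rightarrow> bool" where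
  "rest z \<longleftrightarrow> z \<in> extensional (coords d {1..K}) \<and> (\<forall>j\<in>coords d {1..K} - {(k0, 0)}. z j \<in> levels j)"

lemma pts_iff: "z \<in> pts \<longleftrightarrow> rest z \<and> z (k0, 0) \<in> levels (k0, 0)"
  using k0_coord by (auto simp: pts_def rest_def PiE_iff)

lemma even_pts_iff: "z \<in> even_pts \<longleftrightarrow> rest z \<and> z (k0, 0) \<in> even_levels (k0, 0)"
proof -
  have "even_levels j = levels j" if "j \<noteq> (k0, 0)" for j using that by (simp add: even_levels_def)
  then show ?thesis
    unfolding even_pts_def rest_def PiE_iff using k0_coord by (metis DiffE DiffI singletonD singletonI)
qed

sublocale paired_weights pts even_pts "shift (1 / (2 * real m))" "shift (- (1 / (2 * real m)))" \<alpha>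
proof
  show "finite even_pts"
    unfolding even_pts_def by (intro finite_PiE finite_coords finite_levels) auto
  have "0 \<in> even_levels j" for j
    using m by (auto simp: even_levels_def levels_def intro!: image_eqI[of _ _ 0])
  then show "even_pts \<noteq> {}"
    unfolding even_pts_def by (auto simp: PiE_eq_empty_iff)
  show "shift (- (1 / (2 * real m))) (shift (1 / (2 * real m)) z) = z" for z
    by (simp add: shift_def)
  have shift: "shift c z \<in> even_pts \<longleftrightarrow> rest z \<and> z (k0, 0) + c \<in> even_levels (k0, 0)"
    "shift c z \<in> pts \<longleftrightarrow> rest z \<and> z (k0, 0) + c \<in> levels (k0, 0)" for c z
  proof -
    have other: "shift c z j = z j" if "j \<noteq> (k0, 0)" for j using that by (simp add: shift_def)
    have "(\<forall>j. j \<notin> coords d {1..K} \<longrightarrow> shift c z j = undefined) = (\<forall>j. j \<notin> coords d {1..K} \<longrightarrow> z j = undefined)"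
      by (metis other k0_coord)
    moreover have "(\<forall>j\<in>coords d {1..K} - {(k0, 0)}. shift c z j \<in> levels j) = (\<forall>j\<in>coords d {1..K} - {(k0, 0)}. z j \<in> levels j)"
      by (rule ball_cong) (simp_all add: other)
    ultimately have "rest (shift c z) = rest z"
      unfolding rest_def extensional_def mem_Collect_eq by simp
    then show "shift c z \<in> even_pts \<longleftrightarrow> rest z \<and> z (k0, 0) + c \<in> even_levels (k0, 0)"
      "shift c z \<in> pts \<longleftrightarrow> rest z \<and> z (k0, 0) + c \<in> levels (k0, 0)"
      unfolding pts_iff even_pts_iff by (simp_all add: shift_def)
  qed
  show "shift (1 / (2 * real m)) z \<notin> even_pts" if "z \<in> even_pts" for z
  proof
    assume "shift (1 / (2 * real m)) z \<in> even_pts"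
    then have "z (k0, 0) + 1 / (2 * real m) \<in> even_levels (k0, 0)" by (simp only: shift)
    moreover have "z (k0, 0) + 1 / (2 * real m) \<in> (\<lambda>t. t + 1 / (2 * real m)) ` even_levels (k0, 0)"
      using that by (intro imageI) (simp only: even_pts_iff)
    ultimately show False using disjoint_iff levels_k0(2) by metis
  qed
  show "pts = even_pts \<union> shift (1 / (2 * real m)) ` even_pts"
  proof (intro equalityI subsetI)
    fix z assume z: "z \<in> pts"
    show "z \<in> even_pts \<union> shift (1 / (2 * real m)) ` even_pts"
    proof (cases "z (k0, 0) \<in> even_levels (k0, 0)")
      case True
      then show ?thesis using z by (simp add: pts_iff even_pts_iff)
    next
      case False
      then obtain t where t: "t \<in> even_levels (k0, 0)" "z (k0, 0) = t + 1 / (2 * real m)"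
        using z unfolding pts_iff levels_k0(1) by auto
      then have "z (k0, 0) + - (1 / (2 * real m)) \<in> even_levels (k0, 0)" by simp
      then have "shift (- (1 / (2 * real m))) z \<in> even_pts"
        using z by (simp only: shift pts_iff)
      moreover have "z = shift (1 / (2 * real m)) (shift (- (1 / (2 * real m))) z)"
        by (simp add: shift_def)
      ultimately show ?thesis by blast
    qed
  next
    fix z assume "z \<in> even_pts \<union> shift (1 / (2 * real m)) ` even_pts"
    then consider "z \<in> even_pts" | y where "y \<in> even_pts" "z = shift (1 / (2 * real m)) y" by blast
    then show "z \<in> pts"
    proof cases
      case 1
      then show ?thesis by (simp add: pts_iff even_pts_iff levels_k0(1))
    next
      case 2
      from 2(1) have y: "rest y" "y (k0, 0) \<in> even_levels (k0, 0)" by (simp_all only: even_pts_iff)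
      from imageI[OF y(2), of "\<lambda>t. t + 1 / (2 * real m)"] y(1)
      show ?thesis unfolding 2(2) shift levels_k0(1) by (intro conjI UnI2)
    qed
  qed
qed (use \<alpha> in auto)

lemma levels_bounds: "t \<in> levels j \<Longrightarrow> 0 \<le> t \<and> t \<le> 1"
  using m by (auto simp: levels_def split: if_splits)

lemma levels_separated:
  assumes "s \<in> levels j" "t \<in> levels j" "s \<noteq> t" shows "1 / (2 * real m) \<le> \<bar>s - t\<bar>"
proof -
  obtain a b :: nat where ab: "s = real a / (2 * real m)" "t = real b / (2 * real m)" "a \<noteq> b"
    using assms by (fastforce simp: levels_def split: if_splits)
  have "1 \<le> \<bar>real a - real b\<bar>" using ab(3) by linarith
  then have "1 / (2 * real m) \<le> \<bar>real a - real b\<bar> / (2 * real m)"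
    by (intro divide_right_mono) auto
  also have "\<dots> = \<bar>s - t\<bar>" using m by (simp add: ab diff_divide_distrib[symmetric])
  finally show ?thesis .
qed

lemma grid_law_weight: "grid_law d K pts (weight E) (1 / (2 * real m))"
proof
  show "finite pts" by (rule finite_pairs)
  show "pts \<noteq> {}" using Z0_ne Z by auto
  show "pts \<subseteq> space (cube d {1..K})"
    unfolding pts_def space_cube using levels_bounds by (intro PiE_mono) fastforce
  show "0 < 1 / (2 * real m)" using m by simp
  show "1 / (2 * real m) \<le> \<bar>x j - y j\<bar>" if "x \<in> pts" "y \<in> pts" "x j \<noteq> y j" for x y j
  proof (cases "j \<in> coords d {1..K}")
    case True
    then show ?thesis using that by (intro levels_separated) (auto simp: pts_def)
  next
    case False
    then show ?thesis using that PiE_arb[of x _ _ j] PiE_arb[of y _ _ j] by (auto simp: pts_def)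
  qed
qed (use weight_pos sum_weight in auto)

lemma pts_frozen: "x \<in> pts \<Longrightarrow> j \<in> coords d {1..K} \<Longrightarrow> fst j \<notin> S \<Longrightarrow> x j = 0"
  unfolding pts_def by (drule (1) PiE_mem) (simp add: levels_def)

lemma proj_eqI:
  assumes "x \<in> pts" "y \<in> pts" "I \<subseteq> {1..K}" "\<And>j. j \<in> coords d I \<Longrightarrow> fst j \<in> S \<Longrightarrow> x j = y j"
  shows "proj d I x = proj d I y"
proof
  fix j
  show "proj d I x j = proj d I y j"
  proof (cases "j \<in> coords d I")
    case True
    then have "j \<in> coords d {1..K}" using coords_mono[OF assms(3)] by auto
    then have "x j = y j"
      using True assms(4) pts_frozen[OF assms(1)] pts_frozen[OF assms(2)] by (cases "fst j \<in> S") simp_all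
    then show ?thesis by (simp add: proj_def)
  qed (simp add: proj_def)
qed

lemma card_pts: "card pts = (2 * m) ^ (\<Sum>k\<in>S. d k)"
proof -
  have "inj_on (\<lambda>i. real i / (2 * real m)) {..<2 * m}" using m by (auto simp: inj_on_def)
  then have c: "card (levels j) = (if fst j \<in> S then 2 * m else 1)" for j
    by (simp add: levels_def card_image)
  have "card pts = (\<Prod>j\<in>coords d {1..K}. card (levels j))"
    unfolding pts_def by (intro card_PiE finite_coords) auto
  also have "\<dots> = (\<Prod>k\<in>{1..K}. \<Prod>i<d k. card (levels (k, i)))"
    unfolding coords_def by (subst prod.Sigma) (auto simp: split_def)
  also have "\<dots> = (\<Prod>k\<in>{1..K}. if k \<in> S then (2 * m) ^ d k else 1)"
    by (rule prod.cong) (auto simp: c)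
  also have "\<dots> = (\<Prod>k\<in>S. (2 * m) ^ d k)"
    using S(1) by (subst prod.inter_restrict[symmetric]) (auto simp: Int_absorb1)
  also have "\<dots> = (2 * m) ^ (\<Sum>k\<in>S. d k)" by (rule power_sum[symmetric])
  finally show ?thesis .
qed

text \<open>This is the closure property that \<open>cond_mean_diff_le\<close> asks for; it holds
  because the grid is a product set.\<close>

lemma override_pts: "x \<in> pts \<Longrightarrow> y \<in> pts \<Longrightarrow> override_on x y J \<in> pts"
  by (auto simp: pts_def PiE_iff override_on_def extensional_def)

lemma minimax_risk_ge:
  fixes n :: nat
  assumes Q: "\<And>E. grid_law.law d K pts (weight E) \<in> Q" and n: "8 * real n * \<alpha>\<^sup>2 \<le> card pts"
  shows "ennreal (\<alpha> / (64 * real m)) \<le> minimax_risk K d Q n"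
  unfolding minimax_risk_def
proof (rule INF_greatest)
  let ?h = "1 / (2 * real m)"
  fix est assume est: "est \<in> (\<Pi>\<^sub>M i\<in>{..<n}. cube d {1..K}) \<rightarrow>\<^sub>M prob_algebra (cube d {1..K})"
  obtain E where E: "\<alpha> / 8 \<le> (\<Sum>x\<in>{..<n} \<rightarrow>\<^sub>E pts. (\<Prod>i<n. weight E (x i)) *
      (\<Sum>z\<in>pts. \<bar>weight E z - measure (est x) (near d {1..K} (?h / 2) z)\<bar>))"
    using assouad[OF n, of "\<lambda>x z. measure (est x) (near d {1..K} (?h / 2) z)"] by auto
  interpret G: grid_law d K pts "weight E" ?h by (rule grid_law_weight)
  \<comment> \<open>\<open>?h / 4\<close> is the transport factor of \<open>risk_ge\<close>, and
    \<open>\<alpha> / 8\<close> is the bound of \<open>assouad\<close>.\<close>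
  have "\<alpha> / (64 * real m) = ?h / 4 * (\<alpha> / 8)" by simp
  also have "\<dots> \<le> ?h / 4 * (\<Sum>x\<in>{..<n} \<rightarrow>\<^sub>E pts. (\<Prod>i<n. weight E (x i)) *
      (\<Sum>z\<in>pts. \<bar>weight E z - measure (est x) (near d {1..K} (?h / 2) z)\<bar>))"
    using E by (intro mult_left_mono) auto
  finally have "ennreal (\<alpha> / (64 * real m)) \<le> ennreal \<dots>" by (rule ennreal_leI)
  also have "\<dots> \<le> (\<integral>\<^sup>+ x. wasserstein d {1..K} G.law (est x) \<partial>(\<Pi>\<^sub>M i\<in>{..<n}. G.law))"
    by (rule G.risk_ge[OF est])
  also have "\<dots> \<le> (SUP \<mu>\<in>Q. \<integral>\<^sup>+ x. wasserstein d {1..K} \<mu> (est x) \<partial>(\<Pi>\<^sub>M i\<in>{..<n}. \<mu>))"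
    by (rule SUP_upper[OF Q])
  finally show "ennreal (\<alpha> / (64 * real m)) \<le> (SUP \<mu>\<in>Q. \<integral>\<^sup>+ x. wasserstein d {1..K} \<mu> (est x) \<partial>(\<Pi>\<^sub>M i\<in>{..<n}. \<mu>))" .
qed

text \<open>A node outside \<open>S\<close> is constant on the grid. A node in \<open>S\<close> has
  all earlier random nodes among its parents, and the rest of the past is frozen, so its parents
  determine the past.\<close>

lemma law_in_graph_measures:
  assumes G: "\<And>k. k \<in> {1..K} \<Longrightarrow> pa G k \<subseteq> {1..<k}"
    and S_pa: "\<And>k. Suc k \<in> S \<Longrightarrow> S \<inter> {1..k} \<subseteq> pa G (Suc k)"
  shows "grid_law.law d K pts (weight E) \<in> graph_measures K G d"
proof -
  interpret G: grid_law d K pts "weight E" "1 / (2 * real m)" by (rule grid_law_weight)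
  show ?thesis
  proof (rule G.law_graph_measure[OF G])
    fix k assume k: "Suc k \<le> K"
    let ?A = "pa G (Suc k)"
    show "(\<forall>x\<in>pts. \<forall>y\<in>pts. proj d ?A x = proj d ?A y \<longrightarrow> proj d {Suc k} x = proj d {Suc k} y) \<or>
      (\<forall>x\<in>pts. \<forall>y\<in>pts. proj d ?A x = proj d ?A y \<longrightarrow> proj d {1..k} x = proj d {1..k} y)"
    proof (cases "Suc k \<in> S")
      case False
      then have "proj d {Suc k} x = proj d {Suc k} y" if "x \<in> pts" "y \<in> pts" for x y
        using that k by (intro proj_eqI) (auto simp: coords_def)
      then show ?thesis by blast
    next
      case True
      have "proj d {1..k} x = proj d {1..k} y" if xy: "x \<in> pts" "y \<in> pts" "proj d ?A x = proj d ?A y" for x y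
      proof (rule proj_eqI[OF xy(1,2)])
        show "{1..k} \<subseteq> {1..K}" using k by auto
        fix j assume "j \<in> coords d {1..k}" "fst j \<in> S"
        then have "j \<in> coords d ?A" using S_pa[OF True] by (auto simp: coords_def)
        then show "x j = y j" using fun_cong[OF xy(3), of j] by (simp add: proj_def)
      qed
      then show ?thesis by blast
    qed
  qed
qed

text \<open>Weights between \<open>(1 - \<alpha>) / card pts\<close> and
  \<open>(1 + \<alpha>) / card pts\<close> let conditional means oscillate by at most
  \<open>2 * \<alpha> / (1 - \<alpha>\<^sup>2)\<close>. Interpolation on the mesh
  \<open>1 / (2 * real m)\<close> multiplies this by \<open>8 * real m\<close>.\<close>

lemma law_TV_Lipschitz:
  assumes G: "\<And>k. k \<in> {1..K} \<Longrightarrow> pa G k \<subseteq> {1..<k}" and L: "16 * real m * \<alpha> \<le> L * (1 - \<alpha>\<^sup>2)"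
  shows "TV_Lipschitz K G d L (grid_law.law d K pts (weight E))"
proof -
  interpret G: grid_law d K pts "weight E" "1 / (2 * real m)" by (rule grid_law_weight)
  let ?lo = "(1 - \<alpha>) / card pts" and ?hi = "(1 + \<alpha>) / card pts"
  let ?e = "(?hi / ?lo - ?lo / ?hi) / 2"
  have e: "4 * ?e / (1 / (2 * real m)) \<le> L"
  proof -
    have cancel: "(a / c) / (b / c) = a / b" if "0 < c" for a b c :: real using that by simp
    have "?hi / ?lo - ?lo / ?hi = (1 + \<alpha>) / (1 - \<alpha>) - (1 - \<alpha>) / (1 + \<alpha>)"
      unfolding cancel[OF card_Z_pos] ..
    also have "\<dots> = 4 * \<alpha> / (1 - \<alpha>\<^sup>2)"
    proof -
      have "(1 + \<alpha>) / (1 - \<alpha>) - (1 - \<alpha>) / (1 + \<alpha>) = ((1 + \<alpha>) * (1 + \<alpha>) - (1 - \<alpha>) * (1 - \<alpha>)) / ((1 - \<alpha>) * (1 + \<alpha>))"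
        using \<alpha> by (intro diff_frac_eq) auto
      then show ?thesis by (simp add: algebra_simps power2_eq_square)
    qed
    finally have diff: "?hi / ?lo - ?lo / ?hi = 4 * \<alpha> / (1 - \<alpha>\<^sup>2)" .
    have "4 * ?e / (1 / (2 * real m)) = 16 * real m * \<alpha> / (1 - \<alpha>\<^sup>2)"
    proof -
      have mesh: "4 * (t / 2) / (1 / (2 * real m)) = 4 * real m * t" for t by simp
      show ?thesis unfolding mesh diff by simp
    qed
    moreover have "0 < 1 - \<alpha>\<^sup>2" using \<alpha> by (simp add: power_less_one_iff abs_square_less_1)
    ultimately show ?thesis using L by (simp add: pos_divide_le_eq)
  qed
  show ?thesis
  proof (rule G.TV_Lipschitz_law[OF G])
    fix A B assume AB: "A \<subseteq> {1..K}" "B \<subseteq> {1..K}" "A \<inter> B = {}"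
    show "TV_Lipschitz_cond d L G.law B A"
      by (rule G.TV_Lipschitz_cond_law[OF AB(1,2) G.cond_mean_diff_le[OF AB(3,2) override_pts _ weight_bounds] e])
        (use \<alpha> card_Z_pos in auto)
  qed
qed

text \<open>If only one node is random, then all nodes are independent, so the conditional laws do not
  depend on the conditioning value.\<close>

lemma law_TV_Lipschitz_single:
  assumes G: "\<And>k. k \<in> {1..K} \<Longrightarrow> pa G k \<subseteq> {1..<k}" and "S = {k0}" "0 \<le> L"
  shows "TV_Lipschitz K G d L (grid_law.law d K pts (weight E))"
proof -
  interpret G: grid_law d K pts "weight E" "1 / (2 * real m)" by (rule grid_law_weight)
  show ?thesis
  proof (rule G.TV_Lipschitz_law[OF G])
    fix A B assume AB: "A \<subseteq> {1..K}" "B \<subseteq> {1..K}" "A \<inter> B = {}"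
    show "TV_Lipschitz_cond d L G.law B A"
    proof (rule G.TV_Lipschitz_cond_law[OF AB(1,2)])
      fix f :: "(nat \<times> nat \<Rightarrow> real) \<Rightarrow> real" and x y assume xy: "x \<in> pts" "y \<in> pts"
      have "G.cond_mean A (\<lambda>z. f (proj d B z)) (proj d A x) = G.cond_mean A (\<lambda>z. f (proj d B z)) (proj d A y)"
      \<comment> \<open>If the random node is not in \<open>A\<close>, all grid points have the same
        \<open>A\<close>-projection; if it is, the \<open>B\<close>-coordinates are frozen.\<close>
      proof (cases "k0 \<in> A")
        case False
        then have "proj d A x = proj d A y"
          using xy AB assms(2) by (intro proj_eqI) (auto simp: coords_def)
        then show ?thesis by simp
      next
        case True
        then have "proj d B z = proj d B x" if "z \<in> pts" for z
          using xy AB assms(2) that by (intro proj_eqI) (auto simp: coords_def)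
        then have "G.cond_mean A (\<lambda>z. f (proj d B z)) (proj d A u) = f (proj d B x)" if "u \<in> pts" for u
          using that by (intro G.cond_mean_const) auto
        then show ?thesis using xy by simp
      qed
      then show "\<bar>G.cond_mean A (\<lambda>z. f (proj d B z)) (proj d A x) - G.cond_mean A (\<lambda>z. f (proj d B z)) (proj d A y)\<bar> \<le> 0"
        by simp
    qed (use assms in auto)
  qed
qed

end

section \<open>Choice of the mesh and the two rates\<close>

lemma exists_root_approx:
  fixes n p :: nat
  assumes "1 \<le> n" "1 \<le> p"
  obtains m :: nat where "1 \<le> m" "real n \<le> real m ^ p" "real m \<le> 2 * real n powr (1 / real p)"
proof
  let ?r = "real n powr (1 / real p)"
  have r: "1 \<le> ?r" using assms by (intro ge_one_powr_ge_zero) auto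
  have c: "?r \<le> real (nat \<lceil>?r\<rceil>)" "real (nat \<lceil>?r\<rceil>) < ?r + 1" using r by linarith+
  show "1 \<le> nat \<lceil>?r\<rceil>" using r c by linarith
  have "real n = ?r ^ p" using assms by (simp add: powr_realpow[symmetric] powr_powr)
  also have "\<dots> \<le> real (nat \<lceil>?r\<rceil>) ^ p" using c by (intro power_mono) auto
  finally show "real n \<le> real (nat \<lceil>?r\<rceil>) ^ p" .
  \<comment> \<open>Since \<open>?r\<close> is at least 1, rounding up at most doubles it.\<close>
  show "real (nat \<lceil>?r\<rceil>) \<le> 2 * ?r" using r c by linarith
qed

lemma minimax_risk_local:
  fixes n :: nat
  assumes G: "sorted_dag K G" and fc: "fully_connected G (pa G k)" and k: "k \<in> {1..K}" "2 \<le> d k"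
    and D: "max 2 (d k) + d_pa G d k = D" and L: "2 \<le> L" and n: "1 \<le> n"
  shows "ennreal (real n powr (- 2 / (2 + real D)) / 3072)
    \<le> minimax_risk K d {\<mu> \<in> graph_measures K G d. TV_Lipschitz K G d L \<mu>} n"
proof -
  obtain m :: nat where root: "1 \<le> m" "real n \<le> real m ^ (2 + D)" "real m \<le> 2 * real n powr (1 / real (2 + D))"
    using exists_root_approx[OF n, of "2 + D"] by auto
  have pa: "pa G i \<subseteq> {1..<i}" for i using G by (fastforce simp: sorted_dag_def pa_def)
  \<comment> \<open>For \<open>L = 2\<close> the Lipschitz condition forces a constant above 8 in
    place of 12; with 12 it reads 4/3 against \<open>L * (1 - \<alpha>\<^sup>2)\<close>.\<close>
  define \<alpha> where "\<alpha> = 1 / (12 * real m)"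
  have small: "0 < \<alpha>" "\<alpha> \<le> 1 / 12" "real m * \<alpha> = 1 / 12" using root(1) by (simp_all add: \<alpha>_def)
  interpret perturbed_grid d K "insert k (pa G k)" m k \<alpha>
    using pa[of k] k root(1) small by unfold_locales auto
  have "finite (pa G k)" using pa[of k] finite_subset by blast
  \<comment> \<open>Since \<open>2 \<le> d k\<close>, the cut-off in \<open>max 2 (d k)\<close> is
    inactive, and \<open>D\<close> counts the random coordinates.\<close>
  then have card: "card pts = (2 * m) ^ D"
    using pa[of k] k D unfolding card_pts by (subst sum.insert) (auto simp: d_pa_def)
  have "ennreal (\<alpha> / (64 * real m)) \<le> minimax_risk K d {\<mu> \<in> graph_measures K G d. TV_Lipschitz K G d L \<mu>} n"
  proof (rule minimax_risk_ge)
    fix E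
    have "grid_law.law d K pts (weight E) \<in> graph_measures K G d"
    proof (rule law_in_graph_measures[OF pa])
      fix i assume "Suc i \<in> insert k (pa G k)"
      then show "insert k (pa G k) \<inter> {1..i} \<subseteq> pa G (Suc i)"
      proof
        assume "Suc i = k" then show ?thesis by auto
      next
        assume i: "Suc i \<in> pa G k"
        \<comment> \<open>This excludes \<open>k\<close> from the earlier nodes. The remaining ones
          are parents of \<open>k\<close>, so full connectedness joins them to
          \<open>Suc i\<close>.\<close>
        then have "Suc i < k" using pa[of k] by auto
        then show ?thesis using fc i by (auto simp: fully_connected_def) (auto simp: pa_def)
      qed
    qed
    moreover have "TV_Lipschitz K G d L (grid_law.law d K pts (weight E))"
    proof (rule law_TV_Lipschitz[OF pa])
      have "\<alpha>\<^sup>2 \<le> (1 / 12)\<^sup>2" using small by (intro power_mono) auto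
      then have "2 * (1 - (1 / 12)\<^sup>2) \<le> L * (1 - \<alpha>\<^sup>2)"
        using L by (intro mult_mono) (auto simp: power2_eq_square)
      then show "16 * real m * \<alpha> \<le> L * (1 - \<alpha>\<^sup>2)" using small(3) by (simp add: power2_eq_square)
    qed
    ultimately show "grid_law.law d K pts (weight E) \<in> {\<mu> \<in> graph_measures K G d. TV_Lipschitz K G d L \<mu>}" by simp
    \<comment> \<open>The extra exponent 2 in the choice of \<open>m\<close> is absorbed by
      \<open>\<alpha>\<^sup>2\<close>, which is of order \<open>1 / m\<^sup>2\<close>.\<close>
    have "8 * real n * \<alpha>\<^sup>2 \<le> 8 * (real m ^ D * (real m)\<^sup>2) * \<alpha>\<^sup>2"
      using root(2) by (intro mult_right_mono mult_left_mono) (auto simp: power_add power2_eq_square mult_ac)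
    also have "\<dots> = 8 * real m ^ D * (real m * \<alpha>)\<^sup>2" by (simp add: power_mult_distrib)
    also have "\<dots> \<le> real m ^ D" by (simp add: small(3) power2_eq_square)
    also have "\<dots> \<le> (2 * real m) ^ D" by (rule power_mono) auto
    also have "\<dots> = real (card pts)" unfolding card by simp
    finally show "8 * real n * \<alpha>\<^sup>2 \<le> real (card pts)" .
  qed
  moreover have "real n powr (- 2 / (2 + real D)) / 3072 \<le> \<alpha> / (64 * real m)"
  proof -
    let ?r = "real n powr (1 / real (2 + D))"
    have r: "0 < ?r" using n by simp
    have "real n powr (- 2 / (2 + real D)) = ?r powr (- 2)" by (simp add: powr_powr)
    also have "\<dots> = 1 / ?r\<^sup>2" using r by (simp add: powr_minus_divide powr_numeral)
    \<comment> \<open>768 is 64 times the 12 in \<open>\<alpha>\<close>; rounding in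
      \<open>m\<close> costs a further factor of 4.\<close>
    finally have "real n powr (- 2 / (2 + real D)) / 3072 = 1 / (768 * (2 * ?r)\<^sup>2)"
      by (simp add: power_mult_distrib)
    also have "\<dots> \<le> 1 / (768 * (real m)\<^sup>2)"
      using root r by (intro divide_left_mono mult_left_mono power_mono mult_pos_pos) auto
    also have "\<dots> = \<alpha> / (64 * real m)" by (simp add: \<alpha>_def power2_eq_square)
    finally show ?thesis .
  qed
  ultimately show ?thesis using ennreal_leI order_trans by blast
qed

lemma minimax_risk_single_node:
  fixes n :: nat
  assumes G: "sorted_dag K G" and k: "k \<in> {1..K}" "1 \<le> d k" and L: "0 \<le> L" and n: "1 \<le> n"
  shows "ennreal (real n powr (- 1 / real (d k)) / 512)
    \<le> minimax_risk K d {\<mu> \<in> graph_measures K G d. TV_Lipschitz K G d L \<mu>} n"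
proof -
  obtain m :: nat where root: "1 \<le> m" "real n \<le> real m ^ d k" "real m \<le> 2 * real n powr (1 / real (d k))"
    using exists_root_approx[OF n k(2)] by auto
  have pa: "pa G i \<subseteq> {1..<i}" for i using G by (fastforce simp: sorted_dag_def pa_def)
  \<comment> \<open>With a single random node the Lipschitz condition does not bound the tilt. The
    value 1/4 makes \<open>8 * real n * \<alpha>\<^sup>2\<close> equal to n/2.\<close>
  interpret perturbed_grid d K "{k}" m k "1/4"
    using k root(1) by unfold_locales auto
  have card: "card pts = (2 * m) ^ d k" by (simp add: card_pts)
  have "ennreal (1 / 4 / (64 * real m)) \<le> minimax_risk K d {\<mu> \<in> graph_measures K G d. TV_Lipschitz K G d L \<mu>} n"
  proof (rule minimax_risk_ge)
    fix E
    have "grid_law.law d K pts (weight E) \<in> graph_measures K G d"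
      by (rule law_in_graph_measures[OF pa]) auto
    then show "grid_law.law d K pts (weight E) \<in> {\<mu> \<in> graph_measures K G d. TV_Lipschitz K G d L \<mu>}"
      using law_TV_Lipschitz_single[OF pa refl L] by simp
    have "8 * real n * (1 / 4)\<^sup>2 \<le> real n" by (simp add: power2_eq_square)
    also have "\<dots> \<le> real m ^ d k" by (rule root(2))
    also have "\<dots> \<le> (2 * real m) ^ d k" by (rule power_mono) auto
    also have "\<dots> = real (card pts)" unfolding card by simp
    finally show "8 * real n * (1 / 4)\<^sup>2 \<le> real (card pts)" .
  qed
  moreover have "real n powr (- 1 / real (d k)) / 512 \<le> 1 / 4 / (64 * real m)"
  proof -
    let ?r = "real n powr (1 / real (d k))"
    have r: "0 < ?r" using n by simp
    have "real n powr (- 1 / real (d k)) / 512 = 1 / (256 * (2 * ?r))"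
      by (simp add: powr_minus_divide)
    also have "\<dots> \<le> 1 / (256 * real m)"
      using root r by (intro divide_left_mono mult_left_mono mult_pos_pos) auto
    finally show ?thesis by simp
  qed
  ultimately show ?thesis using ennreal_leI order_trans by blast
qed

theorem proposition1p6:
  "\<exists>C::real. C > 0 \<and>
    (\<forall>(K::nat) (G::(nat \<times> nat) set) (d::nat \<Rightarrow> nat) (L::real) (n::nat).
      sorted_dag K G \<longrightarrow>
      (\<forall>k\<in>{1..K}. d k \<ge> 1) \<longrightarrow>
      (\<forall>k\<in>{1..K}. fully_connected G (pa G k)) \<longrightarrow>
      L \<ge> 2 \<longrightarrow>
      (\<exists>k\<in>{1..K}. d k \<ge> 2 \<and> max 2 (d k) + d_pa G d k = d_loc K G d) \<longrightarrow>
      n \<ge> 1 \<longrightarrow>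
      minimax_risk K d {\<mu> \<in> graph_measures K G d. TV_Lipschitz K G d L \<mu>} n
        \<ge> ennreal (C * (real n powr (- 2 / (2 + real (d_loc K G d)))
                       + real n powr (- 1 / real (d_max K d)))))"
proof (rule exI[of _ "1 / 6144"], intro conjI allI impI)
  fix K G d L and n :: nat
  assume G: "sorted_dag K G" and fc: "\<forall>k\<in>{1..K}. fully_connected G (pa G k)" and L: "2 \<le> (L::real)"
    and loc: "\<exists>k\<in>{1..K}. d k \<ge> 2 \<and> max 2 (d k) + d_pa G d k = d_loc K G d" and n: "1 \<le> n"
  let ?R = "minimax_risk K d {\<mu> \<in> graph_measures K G d. TV_Lipschitz K G d L \<mu>} n"
  let ?a = "real n powr (- 2 / (2 + real (d_loc K G d)))" and ?b = "real n powr (- 1 / real (d_max K d))"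
  obtain k where k: "k \<in> {1..K}" "2 \<le> d k" "max 2 (d k) + d_pa G d k = d_loc K G d" using loc by blast
  have a: "ennreal (?a / 3072) \<le> ?R"
    using fc k by (intro minimax_risk_local[OF G _ k L n]) auto
  have "d_max K d \<in> (\<lambda>k. max 2 (d k)) ` {1..K}"
    unfolding d_max_def using k by (intro Max_in) auto
  moreover have "d k \<le> d_max K d"
  proof -
    have "max 2 (d k) \<le> d_max K d" unfolding d_max_def by (rule Max_ge) (use k(1) in simp_all)
    then show ?thesis by simp
  qed
  ultimately obtain l' where l': "l' \<in> {1..K}" "d_max K d = max 2 (d l')" "d k \<le> max 2 (d l')" by auto
  \<comment> \<open>The maximum \<open>d_max\<close> may be 2 merely by the cut-off, at a node of
    smaller dimension. In that case \<open>d k\<close> is squeezed to 2, and \<open>k\<close> itself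
    serves.\<close>
  obtain l where l: "l \<in> {1..K}" "d l = d_max K d" "1 \<le> d l"
  proof (cases "2 \<le> d l'")
    case True
    with l' show ?thesis by (intro that[of l']) auto
  next
    case False
    with l' k show ?thesis by (intro that[of k]) auto
  qed
  then have b: "ennreal (?b / 512) \<le> ?R"
    using minimax_risk_single_node[where d=d, OF G l(1,3) _ n, of L] L by simp
  \<comment> \<open>The larger rate is at least half of the sum, and 6144 is twice 3072, the worse
    of the two denominators.\<close>
  show "ennreal (1 / 6144 * (?a + ?b)) \<le> ?R"
  proof (cases "?b \<le> ?a")
    case True
    then have "1 / 6144 * (?a + ?b) \<le> ?a / 3072" by simp
    then show ?thesis using a ennreal_leI order_trans by blast
  next
    case False
    moreover have "1 / 6144 * (s + t) \<le> t / 512" if "\<not> t \<le> s" "0 \<le> t" for s t :: real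
      using that by simp
    ultimately have "1 / 6144 * (?a + ?b) \<le> ?b / 512" using powr_ge_zero by blast
    then show ?thesis using b ennreal_leI order_trans by blast
  qed
qed simp

end
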